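(* Let $q(dy|x)$ be a homogeneous (conservative stable) $Q$-function on the nonempty Borel space $S$, and let $(X_t)$ be the homogeneous Markov pure jump process with transition function $P_q$. Consider the following condition (C): there exist a monotone nondecreasing sequence $(S_n)\subseteq\mathcal B(S)$ and a $[0,\infty)$-valued measurable function $V$ on $S$ such that (i) $S_n\uparrow S$ as $n\uparrow\infty$; (ii) $\sup_{x\in S_n}q_x<\infty$ for each $n$; (iii) $\inf_{x\in S\setminus S_n}V(x)\uparrow\infty$ as $n\uparrow\infty$; (iv) for some constant $\alpha\in(0,\infty)$, $\int_SV(y)q(dy|x)\le\alpha V(x)$ for all $x\in S$. Then the following hold. (a) If condition (C) is satisfied, then $(X_t)$ is nonexplosive. (b) Suppose $S$ is a locally compact separable metric space, and the functions $x\in S\mapsto q_x$ and $x\in S\mapsto\int_Sf(y)q(dy|x)$ are continuous for each bounded continuous function $f$ on $S$. If $(X_t)$ is nonexplosive, then condition (C) holds, where the sets $S_n$ can be taken as compact sets in $S$ such that $\sup_{x\in S_n}V(x)<\infty$ for all $n=1,2,\dots$. (c) $(X_t)$ is nonexplosive if and only if for each $\alpha\in(0,\infty)$ there is no nontrivial (i.e. not identically zero) $[0,1]$-valued measurable function $U$ on $S$ satisfying $\alpha U(x)=\int_SU(y)q(dy|x)$ for all $x\in S$. (d) $(X_t)$ is explosive if and only if there exist a nontrivial bounded nonnegative measurable function $U$ on $S$ and some $\alpha>0$ such that $\alpha U(x)\le\int_SU(y)q(dy|x)$ for all $x\in S$.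
   Context: $S$ is a nonempty Borel space with Borel $\sigma$-algebra $\mathcal B(S)$; measurability means Borel measurability; the infimum over the empty set is $+\infty$. A homogeneous (conservative stable) $Q$-function on $S$ is a Borel-measurable signed kernel $q(dy|x)$ on $\mathcal B(S)$ from $S$ such that $0\le q(\Gamma|x)<\infty$ whenever $x\notin\Gamma\in\mathcal B(S)$, and $q(S|x)=0$ for all $x\in S$. Put $\tilde q(\Gamma|x):=q(\Gamma\setminus\{x\}|x)$ and $q_x:=-q(\{x\}|x)<\infty$. For nonnegative $V$, $\int_SV(y)q(dy|x):=\int_SV(y)\tilde q(dy|x)-q_xV(x)$ (so (iv) includes $\int_SV(y)\tilde q(dy|x)<\infty$). The $q$-transition function is $P_q:=\sum_{n\ge0}P_q^{(n)}$, where for $0\le s\le t<\infty$, $P_q^{(0)}(s,x,t,\Gamma)=\delta_x(\Gamma)e^{-q_x(t-s)}$ and $P_q^{(n+1)}(s,x,t,\Gamma)=\int_s^te^{-q_x(u-s)}\left(\int_SP_q^{(n)}(u,z,t,\Gamma)\tilde q(dz|x)\right)du$. The Markov pure jump process $(X_t)$ with transition function $P_q$ and initial state $x\in S$ (law $\mathbb P^q_x$): $x_0=x$, $t_0=0$, and, given the past up to the jump moment $t_n<\infty$ with post-jump state $x_n\in S$, the next pair $(t_{n+1},x_{n+1})$ has conditional law $e^{-q_{x_n}(t-t_n)}\tilde q(dy|x_n)\,dt$ on $(t_n,\infty)\times S$, the remaining mass being put on $t_{n+1}=\infty$, $x_{n+1}=x_\infty$, where $x_\infty\notin S$ is an isolated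 cemetery point; $X_t=x_n$ for $t_n\le t<t_{n+1}$ and $X_t=x_\infty$ for $t\ge t_\infty:=\lim_nt_n$. The process is nonexplosive if $\mathbb P_x^q(t_\infty=\infty)=1$ for all $x\in S$, and explosive if $\mathbb P_x^q(t_\infty=\infty)<1$ for some $x\in S$. *)

theory Defs
  imports "HOL-Probability.Probability"
begin

text \<open>
  A Borel space is, up to homeomorphism, a Borel subset of a Polish space.  Accordingly the state
  space is a Borel set \<open>S\<close> of an arbitrary Polish type, with the subspace topology and the trace
  \<open>restrict_space borel S\<close> of the Borel \<open>\<sigma>\<close>-algebra.
\<close>

definition signed_kernel :: "'a::topological_space set \<Rightarrow> ('a \<Rightarrow> 'a set \<Rightarrow> real) \<Rightarrow> bool" where
  "signed_kernel S q \<longleftrightarrow>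
     (\<forall>x\<in>S. q x {} = 0 \<and>
        (\<forall>A :: nat \<Rightarrow> 'a set. range A \<subseteq> sets (restrict_space borel S) \<longrightarrow> disjoint_family A \<longrightarrow>
           (\<lambda>i. q x (A i)) sums q x (\<Union>i. A i))) \<and>
     (\<forall>\<Gamma>\<in>sets (restrict_space borel S). (\<lambda>x. q x \<Gamma>) \<in> borel_measurable (restrict_space borel S))"

text \<open>
  The value \<open>q x \<Gamma>\<close> is \<open>q(\<Gamma>|x)\<close>.  Real values are no restriction: the values off the diagonal are
  finite and \<open>q(S|x) = 0\<close>, so \<open>q({x}|x)\<close> is finite too.
\<close>

definition Q_function :: "'a::topological_space set \<Rightarrow> ('a \<Rightarrow> 'a set \<Rightarrow> real) \<Rightarrow> bool" where
  "Q_function S q \<longleftrightarrow> signed_kernel S q \<and>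
     (\<forall>x\<in>S. \<forall>\<Gamma>\<in>sets (restrict_space borel S). x \<notin> \<Gamma> \<longrightarrow> 0 \<le> q x \<Gamma>) \<and>
     (\<forall>x\<in>S. q x S = 0)"

definition qrate :: "('a \<Rightarrow> 'a set \<Rightarrow> real) \<Rightarrow> 'a \<Rightarrow> real" where
  "qrate q x = - q x {x}"

definition qtilde :: "'a::topological_space set \<Rightarrow> ('a \<Rightarrow> 'a set \<Rightarrow> real) \<Rightarrow> 'a \<Rightarrow> 'a measure" where
  "qtilde S q x = measure_of S (sets (restrict_space borel S)) (\<lambda>\<Gamma>. ennreal (q x (\<Gamma> - {x})))"

text \<open>
  Meaningful when \<open>f\<close> is integrable with respect to \<open>qtilde S q x\<close>, which is a finite measure for
  \<open>x \<in> S\<close>.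
\<close>

definition qint :: "'a::topological_space set \<Rightarrow> ('a \<Rightarrow> 'a set \<Rightarrow> real) \<Rightarrow> ('a \<Rightarrow> real) \<Rightarrow> 'a \<Rightarrow> real" where
  "qint S q f x = (\<integral>y. f y \<partial>qtilde S q x) - qrate q x * f x"

subsection \<open>The transition function\<close>

primrec Pq_iter ::
  "nat \<Rightarrow> 'a::topological_space set \<Rightarrow> ('a \<Rightarrow> 'a set \<Rightarrow> real) \<Rightarrow> real \<Rightarrow> 'a \<Rightarrow> real \<Rightarrow> 'a set \<Rightarrow> ennreal"
where
  "Pq_iter 0 S q s x t \<Gamma> = indicator \<Gamma> x * ennreal (exp (- qrate q x * (t - s)))"
| "Pq_iter (Suc n) S q s x t \<Gamma> =
     (\<integral>\<^sup>+u\<in>{s..t}. ennreal (exp (- qrate q x * (u - s))) *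
        (\<integral>\<^sup>+z. Pq_iter n S q u z t \<Gamma> \<partial>qtilde S q x) \<partial>lborel)"

definition Pq ::
  "'a::topological_space set \<Rightarrow> ('a \<Rightarrow> 'a set \<Rightarrow> real) \<Rightarrow> real \<Rightarrow> 'a \<Rightarrow> real \<Rightarrow> 'a set \<Rightarrow> ennreal" where
  "Pq S q s x t \<Gamma> = (\<Sum>n. Pq_iter n S q s x t \<Gamma>)"

subsection \<open>The jump process\<close>

text \<open>The state space with the cemetery \<open>None\<close> adjoined as an isolated point.\<close>

definition cemetery_space :: "'a::topological_space set \<Rightarrow> 'a option measure" where
  "cemetery_space S = sigma (insert None (Some ` S))
     (insert {None} ((\<lambda>\<Gamma>. Some ` \<Gamma>) ` sets (restrict_space borel S)))"

definition jump_pair_space :: "'a::topological_space set \<Rightarrow> (ennreal \<times> 'a option) measure" where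
  "jump_pair_space S = borel \<Otimes>\<^sub>M cemetery_space S"

definition jump_density_part ::
  "'a::topological_space set \<Rightarrow> ('a \<Rightarrow> 'a set \<Rightarrow> real) \<Rightarrow> real \<Rightarrow> 'a \<Rightarrow> (ennreal \<times> 'a option) set \<Rightarrow> ennreal"
where
  "jump_density_part S q s x B =
     (\<integral>\<^sup>+t\<in>{s<..}. ennreal (exp (- qrate q x * (t - s))) *
        (\<integral>\<^sup>+y. indicator B (ennreal t, Some y) \<partial>qtilde S q x) \<partial>lborel)"

text \<open>
  The probability that the next pair of jump moment and post-jump state lies in \<open>B\<close>, given the
  current pair.  After the jump moment \<open>\<infinity>\<close> or the cemetery state the pair stays at \<open>(\<infinity>, None)\<close>.
\<close>

definition next_jump ::
  "'a::topological_space set \<Rightarrow> ('a \<Rightarrow> 'a set \<Rightarrow> real) \<Rightarrow> ennreal \<times> 'a option \<Rightarrow>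
     (ennreal \<times> 'a option) set \<Rightarrow> ennreal"
where
  "next_jump S q p B =
     (case p of (s, z) \<Rightarrow>
        (case z of
           None \<Rightarrow> indicator B (\<infinity>, None)
         | Some x \<Rightarrow>
             (if s = \<infinity> then indicator B (\<infinity>, None)
              else jump_density_part S q (enn2real s) x B +
                   (1 - jump_density_part S q (enn2real s) x UNIV) * indicator B (\<infinity>, None))))"

text \<open>The \<open>\<sigma>\<close>-algebra of the past up to the \<open>n\<close>-th jump moment \<open>T n\<close> with post-jump state \<open>Z n\<close>.\<close>

definition jump_history ::
  "'a::topological_space set \<Rightarrow> 'w measure \<Rightarrow> (nat \<Rightarrow> 'w \<Rightarrow> ennreal) \<Rightarrow> (nat \<Rightarrow> 'w \<Rightarrow> 'a option) \<Rightarrow>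
     nat \<Rightarrow> 'w measure"
where
  "jump_history S M T Z n =
     vimage_algebra (space M) (\<lambda>\<omega>. \<lambda>i\<in>{..n}. (T i \<omega>, Z i \<omega>)) (Pi\<^sub>M {..n} (\<lambda>_. jump_pair_space S))"

text \<open>
  Under \<open>M\<close>, the family \<open>X\<close> is the Markov pure jump process with \<open>Q\<close>-function \<open>q\<close> and initial state
  \<open>x\<close>, with jump moments \<open>T n\<close> and post-jump states \<open>Z n\<close>.
\<close>

definition pure_jump_process ::
  "'a::topological_space set \<Rightarrow> ('a \<Rightarrow> 'a set \<Rightarrow> real) \<Rightarrow> 'a \<Rightarrow> 'w measure \<Rightarrow>
     (nat \<Rightarrow> 'w \<Rightarrow> ennreal) \<Rightarrow> (nat \<Rightarrow> 'w \<Rightarrow> 'a option) \<Rightarrow> (real \<Rightarrow> 'w \<Rightarrow> 'a option) \<Rightarrow> bool"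
where
  "pure_jump_process S q x M T Z X \<longleftrightarrow>
     prob_space M \<and>
     (\<forall>n. T n \<in> borel_measurable M) \<and>
     (\<forall>n. Z n \<in> measurable M (cemetery_space S)) \<and>
     (\<forall>t\<ge>0. X t \<in> measurable M (cemetery_space S)) \<and>
     (AE \<omega> in M. T 0 \<omega> = 0 \<and> Z 0 \<omega> = Some x) \<and>
     (\<forall>n. \<forall>B\<in>sets (jump_pair_space S).
        AE \<omega> in M.
          nn_cond_exp M (jump_history S M T Z n) (\<lambda>\<omega>'. indicator B (T (Suc n) \<omega>', Z (Suc n) \<omega>')) \<omega> =
          next_jump S q (T n \<omega>, Z n \<omega>) B) \<and>
     (AE \<omega> in M. \<forall>t\<ge>0.
        (\<forall>n. T n \<omega> \<le> ennreal t \<and> ennreal t < T (Suc n) \<omega> \<longrightarrow> X t \<omega> = Z n \<omega>) \<and>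
        (lim (\<lambda>n. T n \<omega>) \<le> ennreal t \<longrightarrow> X t \<omega> = None))"

definition nonexplosive ::
  "'a set \<Rightarrow> ('a \<Rightarrow> 'w measure) \<Rightarrow> (nat \<Rightarrow> 'w \<Rightarrow> ennreal) \<Rightarrow> bool" where
  "nonexplosive S P T \<longleftrightarrow>
     (\<forall>x\<in>S. measure (P x) {\<omega> \<in> space (P x). lim (\<lambda>n. T n \<omega>) = \<infinity>} = 1)"

definition explosive ::
  "'a set \<Rightarrow> ('a \<Rightarrow> 'w measure) \<Rightarrow> (nat \<Rightarrow> 'w \<Rightarrow> ennreal) \<Rightarrow> bool" where
  "explosive S P T \<longleftrightarrow>
     (\<exists>x\<in>S. measure (P x) {\<omega> \<in> space (P x). lim (\<lambda>n. T n \<omega>) = \<infinity>} < 1)"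

subsection \<open>The drift condition\<close>

text \<open>
  The infimum is taken in the extended reals, where the infimum over the empty set is \<open>\<infinity>\<close>.
\<close>

definition drift_condition ::
  "'a::topological_space set \<Rightarrow> ('a \<Rightarrow> 'a set \<Rightarrow> real) \<Rightarrow> (nat \<Rightarrow> 'a set) \<Rightarrow> ('a \<Rightarrow> real) \<Rightarrow> bool" where
  "drift_condition S q Sn V \<longleftrightarrow>
     (\<forall>n. Sn n \<in> sets (restrict_space borel S)) \<and>
     V \<in> borel_measurable (restrict_space borel S) \<and> (\<forall>x\<in>S. 0 \<le> V x) \<and>
     incseq Sn \<and> (\<Union>n. Sn n) = S \<and>
     (\<forall>n. bdd_above (qrate q ` Sn n)) \<and>
     incseq (\<lambda>n. INF x\<in>S - Sn n. ereal (V x)) \<and>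
     (\<lambda>n. INF x\<in>S - Sn n. ereal (V x)) \<longlonglongrightarrow> \<infinity> \<and>
     (\<exists>\<alpha>>0. \<forall>x\<in>S. integrable (qtilde S q x) V \<and> qint S q V x \<le> \<alpha> * V x)"

subsection \<open>The law of the jump process is given by the transition function\<close>

text \<open>
  The concluding result \<open>pure_jump_process_law\<close> confirms that \<open>P\<^sub>q\<close> is the transition function of the
  process specified by \<open>pure_jump_process\<close>: \<open>P(X t \<in> \<Gamma>) = P\<^sub>q(0, x, t, \<Gamma>)\<close>.
\<close>

context
  fixes S :: "'a::polish_space set" and q :: "'a \<Rightarrow> 'a set \<Rightarrow> real"
  assumes S: "S \<in> sets borel" and q: "Q_function S q" and ne: "S \<noteq> {}"
begin

abbreviation borelS where "borelS \<equiv> restrict_space borel S"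

lemma space_BS: "space borelS = S" by (simp add: space_restrict_space)

lemma singleton_BS: "x \<in> S \<Longrightarrow> {x} \<in> sets borelS"
  by (subst sets_restrict_space_iff) (use S in auto)

lemma space_qtilde [simp]: "space (qtilde S q x) = S"
  by (simp add: qtilde_def space_measure_of_conv)

lemma sets_qtilde [simp, measurable_cong]: "sets (qtilde S q x) = sets borelS"
  unfolding qtilde_def
  using sets.sets_measure_of_eq[of borelS] space_BS by simp

lemma q_additive:
  assumes "x \<in> S" "A \<in> sets borelS" "B \<in> sets borelS" "A \<inter> B = {}"
  shows "q x (A \<union> B) = q x A + q x B"
proof -
  have sk: "signed_kernel S q" using q by (simp add: Q_function_def)
  have e: "q x {} = 0" using sk assms by (auto simp: signed_kernel_def)
  define f where "f = (\<lambda>i::nat. if i = 0 then A else if i = 1 then B else {})"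
  have "range f \<subseteq> sets borelS" "disjoint_family f"
    using assms by (auto simp: f_def disjoint_family_on_def)
  hence "(\<lambda>i. q x (f i)) sums q x (\<Union>i. f i)"
    using sk assms(1) unfolding signed_kernel_def by blast
  moreover have "(\<Union>i. f i) = A \<union> B"
  proof
    show "(\<Union>i. f i) \<subseteq> A \<union> B" by (auto simp: f_def split: if_splits)
    have "f 0 \<union> f 1 \<subseteq> (\<Union>i. f i)" by blast
    thus "A \<union> B \<subseteq> (\<Union>i. f i)" by (simp add: f_def)
  qed
  moreover have "(\<lambda>i. q x (f i)) sums (\<Sum>i\<in>{0,1}. q x (f i))"
    by (rule sums_finite) (auto simp: f_def e)
  ultimately have "q x (A \<union> B) = (\<Sum>i\<in>{0,1}. q x (f i))"
    using sums_unique2 by fastforce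
  thus ?thesis by (simp add: f_def)
qed

lemma emeasure_qtilde:
  assumes x: "x \<in> S" and G: "G \<in> sets borelS"
  shows "emeasure (qtilde S q x) G = ennreal (q x (G - {x}))"
proof -
  have sk: "signed_kernel S q" using q by (simp add: Q_function_def)
  have sgl: "{x} \<in> sets borelS" by (rule singleton_BS[OF x])
  have nn: "0 \<le> q x (A - {x})" if "A \<in> sets borelS" for A
    using q that sgl x by (auto simp: Q_function_def intro!: sets.Diff)
  have "emeasure (measure_of (space borelS) (sets borelS) (\<lambda>\<Gamma>. ennreal (q x (\<Gamma> - {x})))) G =
     ennreal (q x (G - {x}))"
  proof (rule emeasure_measure_of_sigma[OF sets.sigma_algebra_axioms _ _ G])
    show "positive (sets borelS) (\<lambda>\<Gamma>. ennreal (q x (\<Gamma> - {x})))"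
      using sk x by (auto simp: positive_def signed_kernel_def)
    show "countably_additive (sets borelS) (\<lambda>\<Gamma>. ennreal (q x (\<Gamma> - {x})))"
    proof (rule countably_additiveI)
      fix A :: "nat \<Rightarrow> 'a set"
      assume A: "range A \<subseteq> sets borelS" "disjoint_family A"
      have "range (\<lambda>i. A i - {x}) \<subseteq> sets borelS" using A sgl by (auto intro!: sets.Diff)
      moreover have "disjoint_family (\<lambda>i. A i - {x})"
        using A(2) by (auto simp: disjoint_family_on_def)
      ultimately have "(\<lambda>i. q x (A i - {x})) sums q x (\<Union>i. A i - {x})"
        using sk x unfolding signed_kernel_def by blast
      moreover have "(\<Union>i. A i - {x}) = (\<Union>i. A i) - {x}" by auto
      ultimately have *: "(\<lambda>i. q x (A i - {x})) sums q x ((\<Union>i. A i) - {x})" by simp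
      show "(\<Sum>i. ennreal (q x (A i - {x}))) = ennreal (q x (\<Union> (range A) - {x}))"
        using nn A by (intro suminf_ennreal_eq[OF _ *]) auto
    qed
  qed
  thus ?thesis by (simp add: qtilde_def space_BS)
qed

lemma qrate_eq: 
  assumes x: "x \<in> S" shows "qrate q x = q x (S - {x})"
proof -
  have "S \<in> sets borelS" using space_BS by (metis sets.top)
  hence "q x ({x} \<union> (S - {x})) = q x {x} + q x (S - {x})"
    using x singleton_BS[OF x] by (intro q_additive sets.Diff) auto
  moreover have "{x} \<union> (S - {x}) = S" using x by auto
  moreover have "q x S = 0" using q x by (simp add: Q_function_def)
  ultimately show ?thesis by (simp add: qrate_def)
qed

lemma S_sets: "S \<in> sets borelS" using space_BS by (metis sets.top)

lemma qrate_nonneg: assumes x: "x \<in> S" shows "0 \<le> qrate q x"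
  unfolding qrate_eq[OF x] using q x S_sets singleton_BS[OF x]
  by (auto simp: Q_function_def intro!: sets.Diff)

lemma emeasure_qtilde_S: "x \<in> S \<Longrightarrow> emeasure (qtilde S q x) S = ennreal (qrate q x)"
  by (simp add: emeasure_qtilde S_sets qrate_eq)

lemma finite_qtilde: "x \<in> S \<Longrightarrow> finite_measure (qtilde S q x)"
  by (rule finite_measureI) (simp add: emeasure_qtilde_S)

lemma qtilde_singleton: "x \<in> S \<Longrightarrow> emeasure (qtilde S q x) {x} = 0"
  using q by (simp add: emeasure_qtilde singleton_BS Q_function_def signed_kernel_def)


lemma measurable_emeasure_qtilde:
  assumes G: "G \<in> sets borelS"
  shows "(\<lambda>x. emeasure (qtilde S q x) G) \<in> borel_measurable borelS"
proof -
  obtain B :: "'a set set" where B: "countable B" "topological_basis B"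
    using ex_countable_basis by blast
  have Bne: "B \<noteq> {}"
    using B(2) unfolding topological_basis_def by (metis UNIV_not_empty Union_empty open_UNIV subset_empty)
  define b where "b = from_nat_into B"
  have b_open: "open (b i)" for i
    using topological_basis_open[OF B(2)] from_nat_into[OF Bne] by (simp add: b_def)
  have b_set [measurable]: "b i \<in> sets borel" for i using b_open by simp
  have b_mem: "\<exists>i. y \<in> b i \<and> x \<notin> b i" if "x \<noteq> y" for x y
  proof -
    have "open (- {x})" "y \<in> - {x}" using that by auto
    then obtain C where "C \<in> B" "y \<in> C" "C \<subseteq> - {x}"
      using topological_basisE[OF B(2)] by metis
    moreover then obtain i where "C = b i"
      using from_nat_into_surj[OF B(1)] unfolding b_def by metis
    ultimately show ?thesis by blast
  qed
  define g where "g = (\<lambda>m::nat. \<lambda>x. {i. i \<le> m \<and> x \<notin> b i})"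
  define D where "D = (\<lambda>I::nat set. (\<Union>i\<in>I. b i) \<inter> G)"
  have GS: "G \<subseteq> S" using sets.sets_into_space[OF G] space_BS by simp
  have D: "D I \<in> sets borelS" for I
  proof -
    have "(\<Union>i\<in>I. b i) \<in> sets borel" using b_open by (simp add: open_UN)
    hence "S \<inter> (\<Union>i\<in>I. b i) \<in> sets borelS" unfolding sets_restrict_space by (rule imageI)
    hence "(S \<inter> (\<Union>i\<in>I. b i)) \<inter> G \<in> sets borelS" using G by (rule sets.Int)
    moreover have "(S \<inter> (\<Union>i\<in>I. b i)) \<inter> G = D I" using GS unfolding D_def by blast
    ultimately show ?thesis by metis
  qed
  have "emeasure (qtilde S q x) G = (SUP m. ennreal (q x (D (g m x))))" if x: "x \<in> S" for x
  proof -
    have un: "(\<Union>m. D (g m x)) = G - {x}"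
    proof (intro equalityI subsetI)
      fix y assume "y \<in> G - {x}"
      moreover then obtain i where "y \<in> b i" "x \<notin> b i" using b_mem[of x y] by blast
      ultimately have "y \<in> D (g i x)" unfolding D_def g_def by blast
      thus "y \<in> (\<Union>m. D (g m x))" by blast
    qed (auto simp: D_def g_def)
    have "emeasure (qtilde S q x) G = emeasure (qtilde S q x) (G - {x})"
      using G singleton_BS[OF x]
      by (simp add: emeasure_qtilde x sets.Diff)
    also have "\<dots> = (SUP m. emeasure (qtilde S q x) (D (g m x)))"
      unfolding un[symmetric]
    proof (rule SUP_emeasure_incseq[symmetric])
      show "incseq (\<lambda>m. D (g m x))"
      proof (rule incseq_SucI)
        fix m have "g m x \<subseteq> g (Suc m) x" by (auto simp: g_def)
        thus "D (g m x) \<subseteq> D (g (Suc m) x)" unfolding D_def by blast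
      qed
      show "range (\<lambda>m. D (g m x)) \<subseteq> sets (qtilde S q x)" using D by auto
    qed
    also have "\<dots> = (SUP m. ennreal (q x (D (g m x))))"
    proof (rule SUP_cong[OF refl])
      fix m have "D (g m x) - {x} = D (g m x)" by (auto simp: D_def g_def)
      thus "emeasure (qtilde S q x) (D (g m x)) = ennreal (q x (D (g m x)))"
        by (simp add: emeasure_qtilde x D)
    qed
    finally show ?thesis .
  qed
  moreover have "(\<lambda>x. SUP m. ennreal (q x (D (g m x)))) \<in> borel_measurable borelS"
  proof (rule borel_measurable_SUP)
    fix m :: nat
    show "(\<lambda>x. ennreal (q x (D (g m x)))) \<in> borel_measurable borelS"
    proof (rule measurable_compose_countable'[where f="\<lambda>I x. ennreal (q x (D I))" and I="Pow {..m}"])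
      fix I assume "I \<in> Pow {..m}"
      show "(\<lambda>x. ennreal (q x (D I))) \<in> borel_measurable borelS"
      proof -
        have "(\<lambda>x. q x (D I)) \<in> borel_measurable borelS"
          using q D[of I] unfolding Q_function_def signed_kernel_def by blast
        thus ?thesis by measurable
      qed
    next
      show "g m \<in> borelS \<rightarrow>\<^sub>M count_space (Pow {..m})"
      proof (subst measurable_count_space_eq2, simp, intro conjI ballI)
        show "g m \<in> space borelS \<rightarrow> Pow {..m}" by (auto simp: g_def)
      next
        fix J assume J: "J \<in> Pow {..m}"
        have *: "(\<lambda>x. x) \<in> borelS \<rightarrow>\<^sub>M borel" by (rule measurable_restrict_space1) simp
        have "{x \<in> space borelS. \<forall>i\<in>{..m}. (i \<in> J \<longleftrightarrow> x \<notin> b i)} \<in> sets borelS"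
          using * by measurable
        moreover have "{x \<in> space borelS. \<forall>i\<in>{..m}. (i \<in> J \<longleftrightarrow> x \<notin> b i)} = g m -` {J} \<inter> space borelS"
          using J by (auto simp: g_def)
        ultimately show "g m -` {J} \<inter> space borelS \<in> sets borelS" by simp
      qed
    qed (simp add: countable_finite)
  qed simp
  ultimately show ?thesis
    by (subst measurable_cong) (auto simp: space_BS)
qed

lemma measurable_qrate: "qrate q \<in> borel_measurable borelS"
proof -
  have "(\<lambda>x. enn2real (emeasure (qtilde S q x) S)) \<in> borel_measurable borelS"
    using measurable_emeasure_qtilde[OF S_sets] by measurable
  thus ?thesis
    by (rule measurable_cong[THEN iffD1, rotated])
       (auto simp: space_BS emeasure_qtilde_S qrate_nonneg)
qed

lemma nn_integral_qtilde_measurable: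
  assumes h [measurable]: "h \<in> W \<rightarrow>\<^sub>M borelS" and g [measurable]: "(\<lambda>(w, y). g w y) \<in> borel_measurable (W \<Otimes>\<^sub>M borelS)"
  shows "(\<lambda>w. \<integral>\<^sup>+y. g w y \<partial>qtilde S q (h w)) \<in> borel_measurable W"
proof -
  define c where "c = (\<lambda>w. 1 + qrate q (h w))"
  have hS: "h w \<in> S" if "w \<in> space W" for w using measurable_space[OF h that] space_BS by simp
  have cpos: "0 < c w" if "w \<in> space W" for w
    using qrate_nonneg[OF hS[OF that]] by (simp add: c_def)
  have c [measurable]: "c \<in> borel_measurable W"
    unfolding c_def using measurable_compose[OF h measurable_qrate] by measurable
  define k where "k = (\<lambda>w. scale_measure (ennreal (1 / c w)) (qtilde S q (h w)))"
  have em: "emeasure (k w) A = ennreal (1 / c w) * emeasure (qtilde S q (h w)) A" for w A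
    by (simp add: k_def)
  have k [measurable]: "k \<in> W \<rightarrow>\<^sub>M subprob_algebra borelS"
  proof (rule measurable_subprob_algebra)
    fix w assume w: "w \<in> space W"
    show "subprob_space (k w)"
    proof (rule subprob_spaceI)
      have "emeasure (k w) (space (k w)) = ennreal (1 / c w) * ennreal (qrate q (h w))"
        by (simp add: k_def space_scale_measure emeasure_qtilde_S hS w)
      also have "\<dots> = ennreal (qrate q (h w) / c w)"
        using cpos[OF w] qrate_nonneg[OF hS[OF w]] by (simp add: ennreal_mult[symmetric])
      also have "\<dots> \<le> 1" using cpos[OF w] by (simp add: c_def ennreal_le_1)
      finally show "emeasure (k w) (space (k w)) \<le> 1" .
      show "space (k w) \<noteq> {}" using hS[OF w] by (auto simp: k_def space_scale_measure)
    qed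
    show "sets (k w) = sets borelS" by (simp add: k_def)
  next
    fix A assume A: "A \<in> sets borelS"
    show "(\<lambda>w. emeasure (k w) A) \<in> borel_measurable W"
      unfolding em using measurable_compose[OF h measurable_emeasure_qtilde[OF A]] by measurable
  qed
  have "(\<lambda>w. ennreal (c w) * (\<integral>\<^sup>+y. g w y \<partial>k w)) \<in> borel_measurable W"
    using nn_integral_measurable_subprob_algebra2[OF g k] by measurable
  moreover have "ennreal (c w) * (\<integral>\<^sup>+y. g w y \<partial>k w) = (\<integral>\<^sup>+y. g w y \<partial>qtilde S q (h w))"
    if w: "w \<in> space W" for w
  proof -
    have "g w \<in> borel_measurable borelS" using w by measurable
    hence "g w \<in> borel_measurable (qtilde S q (h w))"
      by (simp add: measurable_cong_sets[OF sets_qtilde refl])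
    hence "(\<integral>\<^sup>+y. g w y \<partial>k w) = ennreal (1 / c w) * (\<integral>\<^sup>+y. g w y \<partial>qtilde S q (h w))"
      unfolding k_def by (rule nn_integral_scale_measure)
    thus ?thesis using cpos[OF w]
      by (simp add: mult.assoc[symmetric] ennreal_mult[symmetric])
  qed
  ultimately show ?thesis by (subst measurable_cong) auto
qed


lemma space_cemetery [simp]: "space (cemetery_space S) = insert None (Some ` S)"
  by (simp add: cemetery_space_def space_measure_of_conv)

lemma cemetery_gen: "insert {None} ((\<lambda>\<Gamma>. Some ` \<Gamma>) ` sets borelS) \<subseteq> Pow (insert None (Some ` S))"
proof -
  have "A \<subseteq> S" if "A \<in> sets borelS" for A using sets.sets_into_space[OF that] space_BS by simp
  thus ?thesis by blast
qed

lemma None_sets [measurable]: "{None} \<in> sets (cemetery_space S)"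
  unfolding cemetery_space_def using cemetery_gen by (subst sets_measure_of) auto

lemma Some_image_sets: "A \<in> sets borelS \<Longrightarrow> Some ` A \<in> sets (cemetery_space S)"
  unfolding cemetery_space_def using cemetery_gen by (subst sets_measure_of) auto

lemma measurable_Some_cemetery [measurable]: "Some \<in> borelS \<rightarrow>\<^sub>M cemetery_space S"
  unfolding cemetery_space_def
proof (rule measurable_measure_of[OF cemetery_gen])
  show "Some \<in> space borelS \<rightarrow> insert None (Some ` S)" by (auto simp: space_BS)
  fix A :: "'a option set" assume "A \<in> insert {None} ((\<lambda>\<Gamma>. Some ` \<Gamma>) ` sets borelS)"
  thus "Some -` A \<inter> space borelS \<in> sets borelS"
  proof
    assume "A = {None}"
    hence "Some -` A \<inter> space borelS = {}" by auto
    thus ?thesis by simp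
  next
    assume "A \<in> (\<lambda>\<Gamma>. Some ` \<Gamma>) ` sets borelS"
    then obtain G where G: "G \<in> sets borelS" "A = Some ` G" by auto
    have "Some -` A \<inter> space borelS = G \<inter> space borelS" unfolding G(2) by (simp add: inj_vimage_image_eq)
    thus ?thesis using G(1) by auto
  qed
qed

lemma measurable_the_cemetery:
  assumes x0: "x0 \<in> S"
  shows "case_option x0 (\<lambda>x. x) \<in> cemetery_space S \<rightarrow>\<^sub>M borelS"
proof (rule measurableI)
  fix z assume "z \<in> space (cemetery_space S)"
  thus "case_option x0 (\<lambda>x. x) z \<in> space borelS" using x0 by (auto simp: space_BS)
next
  fix A assume A: "A \<in> sets borelS"
  hence "A \<subseteq> S" using sets.sets_into_space[OF A] space_BS by simp
  hence "case_option x0 (\<lambda>x. x) -` A \<inter> space (cemetery_space S) =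
      Some ` A \<union> (if x0 \<in> A then {None} else {})" (is "?l = ?r")
    by (auto split: option.splits)
  moreover have "?r \<in> sets (cemetery_space S)"
    using sets.Un[OF Some_image_sets[OF A] None_sets] Some_image_sets[OF A] by simp
  ultimately show "?l \<in> sets (cemetery_space S)" by simp
qed

text \<open>A function of a finite time and a state, extended by \<open>c\<close> to infinite time and the cemetery.\<close>

definition pair_lift :: "(real \<Rightarrow> 'a \<Rightarrow> ennreal) \<Rightarrow> ennreal \<Rightarrow> ennreal \<times> 'a option \<Rightarrow> ennreal" where
  "pair_lift g c p = (if fst p = \<infinity> then c else case snd p of None \<Rightarrow> c | Some x \<Rightarrow> g (enn2real (fst p)) x)"

lemma measurable_pair_lift:
  assumes g: "(\<lambda>(s, x). g s x) \<in> borel_measurable (borel \<Otimes>\<^sub>M borelS)"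
  shows "pair_lift g c \<in> borel_measurable (jump_pair_space S)"
proof -
  obtain x0 where x0: "x0 \<in> S" using ne by blast
  define r where "r = case_option x0 (\<lambda>x::'a. x)"
  have r: "r \<in> cemetery_space S \<rightarrow>\<^sub>M borelS" unfolding r_def by (rule measurable_the_cemetery[OF x0])
  have jp: "jump_pair_space S = borel \<Otimes>\<^sub>M cemetery_space S" by (simp add: jump_pair_space_def)
  have 1: "(\<lambda>p. enn2real (fst p)) \<in> borel_measurable (jump_pair_space S)"
    unfolding jp by measurable
  have 2: "(\<lambda>p. r (snd p)) \<in> jump_pair_space S \<rightarrow>\<^sub>M borelS"
    unfolding jp by (rule measurable_compose[OF measurable_snd r])
  have 3: "(\<lambda>p. g (enn2real (fst p)) (r (snd p))) \<in> borel_measurable (jump_pair_space S)"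
    using measurable_compose[OF measurable_Pair[OF 1 2] g] by simp
  have 4: "{p \<in> space (jump_pair_space S). fst p = \<infinity> \<or> snd p \<in> {None}} \<in> sets (jump_pair_space S)"
  proof -
    have "{p \<in> space (jump_pair_space S). fst p = \<infinity>} \<in> sets (jump_pair_space S)"
      unfolding jp by measurable
    moreover have "snd -` {None} \<inter> space (jump_pair_space S) \<in> sets (jump_pair_space S)"
      unfolding jp by (rule measurable_sets[OF measurable_snd None_sets])
    ultimately have "{p \<in> space (jump_pair_space S). fst p = \<infinity>} \<union> (snd -` {None} \<inter> space (jump_pair_space S)) \<in> sets (jump_pair_space S)"
      by (rule sets.Un)
    moreover have "{p \<in> space (jump_pair_space S). fst p = \<infinity>} \<union> (snd -` {None} \<inter> space (jump_pair_space S)) =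
      {p \<in> space (jump_pair_space S). fst p = \<infinity> \<or> snd p \<in> {None}}" by blast
    ultimately show ?thesis by metis
  qed
  have "pair_lift g c p = (if fst p = \<infinity> \<or> snd p \<in> {None} then c else g (enn2real (fst p)) (r (snd p)))" for p
    by (cases "snd p") (simp_all add: pair_lift_def r_def)
  hence "pair_lift g c = (\<lambda>p. if fst p = \<infinity> \<or> snd p \<in> {None} then c else g (enn2real (fst p)) (r (snd p)))" by blast
  also have "\<dots> \<in> borel_measurable (jump_pair_space S)"
    by (rule measurable_If[OF measurable_const 3 4]) simp
  finally show ?thesis .
qed

definition density_op :: "(ennreal \<times> 'a option \<Rightarrow> ennreal) \<Rightarrow> real \<Rightarrow> 'a \<Rightarrow> ennreal" where
  "density_op f s x = (\<integral>\<^sup>+t\<in>{s<..}. ennreal (exp (- qrate q x * (t - s))) *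
        (\<integral>\<^sup>+y. f (ennreal t, Some y) \<partial>qtilde S q x) \<partial>lborel)"

text \<open>The operator \<open>f \<mapsto> \<integral> f(p') next_jump(p, dp')\<close>; see \<open>jump_op_indicator\<close>.\<close>

definition jump_op :: "(ennreal \<times> 'a option \<Rightarrow> ennreal) \<Rightarrow> ennreal \<times> 'a option \<Rightarrow> ennreal" where
  "jump_op f = pair_lift (\<lambda>s x. density_op f s x + (1 - jump_density_part S q s x UNIV) * f (\<infinity>, None)) (f (\<infinity>, None))"

lemma jump_op_indicator: "jump_op (indicator B) p = next_jump S q p B"
  by (cases p) (auto simp: jump_op_def pair_lift_def next_jump_def density_op_def jump_density_part_def split: option.splits)

lemma density_op_measurable:
  assumes f: "f \<in> borel_measurable (jump_pair_space S)"
  shows "(\<lambda>(s, x). density_op f s x) \<in> borel_measurable (borel \<Otimes>\<^sub>M borelS)"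
proof -
  have f' [measurable]: "f \<in> borel_measurable (borel \<Otimes>\<^sub>M cemetery_space S)"
    using f by (simp add: jump_pair_space_def)
  note [measurable] = measurable_qrate
  have [measurable]: "(\<lambda>w. \<integral>\<^sup>+y. f (ennreal (snd w), Some y) \<partial>qtilde S q (snd (fst w)))
      \<in> borel_measurable ((borel \<Otimes>\<^sub>M borelS) \<Otimes>\<^sub>M lborel)"
    by (rule nn_integral_qtilde_measurable) measurable
  have "(\<lambda>p. \<integral>\<^sup>+t. ennreal (exp (- qrate q (snd p) * (t - fst p))) *
        (\<lambda>w. \<integral>\<^sup>+y. f (ennreal (snd w), Some y) \<partial>qtilde S q (snd (fst w))) (p, t) * indicator {t. fst p < t} t \<partial>lborel)
     \<in> borel_measurable (borel \<Otimes>\<^sub>M borelS)"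
    by (rule lborel.borel_measurable_nn_integral) (unfold split_beta, measurable)
  thus ?thesis by (simp add: density_op_def split_beta greaterThan_def)
qed

lemma jump_density_part_eq: "jump_density_part S q s x B = density_op (indicator B) s x"
  by (simp add: jump_density_part_def density_op_def)

lemma jump_op_measurable:
  assumes f: "f \<in> borel_measurable (jump_pair_space S)"
  shows "jump_op f \<in> borel_measurable (jump_pair_space S)"
proof -
  have "density_op (indicator UNIV) = density_op (\<lambda>_. 1)" by (simp add: fun_eq_iff density_op_def)
  moreover note [measurable] = density_op_measurable[OF f] density_op_measurable[of "\<lambda>_. 1", simplified]
  ultimately show ?thesis unfolding jump_op_def jump_density_part_eq
    by (intro measurable_pair_lift) (simp, measurable)
qed

lemma inner_measurable:
  assumes x: "x \<in> S" and f: "f \<in> borel_measurable (jump_pair_space S)"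
  shows "(\<lambda>t. \<integral>\<^sup>+y. f (ennreal t, Some y) \<partial>qtilde S q x) \<in> borel_measurable borel"
    and "(\<lambda>y. f (\<tau>, Some y)) \<in> borel_measurable (qtilde S q x)"
proof -
  have f' [measurable]: "f \<in> borel_measurable (borel \<Otimes>\<^sub>M cemetery_space S)"
    using f by (simp add: jump_pair_space_def)
  show "(\<lambda>t. \<integral>\<^sup>+y. f (ennreal t, Some y) \<partial>qtilde S q x) \<in> borel_measurable borel"
    by (rule nn_integral_qtilde_measurable[where h="\<lambda>_. x"]) (use x space_BS in simp, measurable)
  have "(\<lambda>y. f (\<tau>, Some y)) \<in> borel_measurable borelS" by measurable
  thus "(\<lambda>y. f (\<tau>, Some y)) \<in> borel_measurable (qtilde S q x)"
    by (simp add: measurable_cong_sets[OF sets_qtilde refl])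
qed

lemma density_op_cmult:
  assumes x: "x \<in> S" and f: "f \<in> borel_measurable (jump_pair_space S)"
  shows "density_op (\<lambda>p. c * f p) s x = c * density_op f s x"
proof -
  note [measurable] = inner_measurable(1)[OF x f]
  have "density_op (\<lambda>p. c * f p) s x = (\<integral>\<^sup>+t. c * (ennreal (exp (- qrate q x * (t - s))) *
        (\<integral>\<^sup>+y. f (ennreal t, Some y) \<partial>qtilde S q x) * indicator {s<..} t) \<partial>lborel)"
    unfolding density_op_def by (simp only: nn_integral_cmult[OF inner_measurable(2)[OF x f]] mult.assoc mult.left_commute[of _ c])
  also have "\<dots> = c * density_op f s x"
    unfolding density_op_def by (rule nn_integral_cmult) measurable
  finally show ?thesis .
qed

lemma density_op_add:
  assumes x: "x \<in> S" and f: "f \<in> borel_measurable (jump_pair_space S)" and g: "g \<in> borel_measurable (jump_pair_space S)"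
  shows "density_op (\<lambda>p. f p + g p) s x = density_op f s x + density_op g s x"
proof -
  note [measurable] = inner_measurable(1)[OF x f] inner_measurable(1)[OF x g]
  have "density_op (\<lambda>p. f p + g p) s x = (\<integral>\<^sup>+t. (ennreal (exp (- qrate q x * (t - s))) *
        (\<integral>\<^sup>+y. f (ennreal t, Some y) \<partial>qtilde S q x) * indicator {s<..} t) + (ennreal (exp (- qrate q x * (t - s))) *
        (\<integral>\<^sup>+y. g (ennreal t, Some y) \<partial>qtilde S q x) * indicator {s<..} t) \<partial>lborel)"
    unfolding density_op_def
    by (simp only: nn_integral_add[OF inner_measurable(2)[OF x f] inner_measurable(2)[OF x g]] distrib_left distrib_right)
  also have "\<dots> = density_op f s x + density_op g s x"
    unfolding density_op_def by (rule nn_integral_add) measurable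
  finally show ?thesis .
qed

lemma density_op_SUP:
  assumes x: "x \<in> S" and U: "\<And>i::nat. U i \<in> borel_measurable (jump_pair_space S)" and inc: "incseq U"
  shows "density_op (\<lambda>p. SUP i. U i p) s x = (SUP i. density_op (U i) s x)" "incseq (\<lambda>i. density_op (U i) s x)"
proof -
  note [measurable] = inner_measurable(1)[OF x U]
  have inc': "U i p \<le> U j p" if "i \<le> j" for i j p using incseqD[OF inc that] by (rule le_funD)
  have "density_op (\<lambda>p. SUP i. U i p) s x = (\<integral>\<^sup>+t. (SUP i. ennreal (exp (- qrate q x * (t - s))) *
        (\<integral>\<^sup>+y. U i (ennreal t, Some y) \<partial>qtilde S q x) * indicator {s<..} t) \<partial>lborel)"
  proof -
    have "(\<integral>\<^sup>+y. (SUP i. U i (ennreal t, Some y)) \<partial>qtilde S q x) = (SUP i. \<integral>\<^sup>+y. U i (ennreal t, Some y) \<partial>qtilde S q x)" for t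
      by (rule nn_integral_monotone_convergence_SUP)
         (use inc' inner_measurable(2)[OF x U] in \<open>auto simp: incseq_def le_fun_def\<close>)
    thus ?thesis unfolding density_op_def
      by (simp only: SUP_mult_left_ennreal SUP_mult_right_ennreal)
  qed
  also have "\<dots> = (SUP i. density_op (U i) s x)"
    unfolding density_op_def
    by (rule nn_integral_monotone_convergence_SUP)
       (auto simp: incseq_def le_fun_def intro!: mult_mono nn_integral_mono inc')
  finally show "density_op (\<lambda>p. SUP i. U i p) s x = (SUP i. density_op (U i) s x)" .
  show "incseq (\<lambda>i. density_op (U i) s x)"
    unfolding density_op_def incseq_def by (auto intro!: mult_mono nn_integral_mono inc')
qed


lemma space_JP: "space (jump_pair_space S) = UNIV \<times> insert None (Some ` S)"
  by (simp add: jump_pair_space_def space_pair_measure)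

lemma jump_op_cmult:
  assumes p: "p \<in> space (jump_pair_space S)" and f: "f \<in> borel_measurable (jump_pair_space S)"
  shows "jump_op (\<lambda>p. c * f p) p = c * jump_op f p"
  using p density_op_cmult[OF _ f]
  by (auto simp: jump_op_def pair_lift_def space_JP distrib_left mult.left_commute)

lemma jump_op_add:
  assumes p: "p \<in> space (jump_pair_space S)" and f: "f \<in> borel_measurable (jump_pair_space S)"
    and g: "g \<in> borel_measurable (jump_pair_space S)"
  shows "jump_op (\<lambda>p. f p + g p) p = jump_op f p + jump_op g p"
  using p density_op_add[OF _ f g]
  by (auto simp: jump_op_def pair_lift_def space_JP distrib_left ac_simps)

lemma jump_op_SUP:
  assumes p: "p \<in> space (jump_pair_space S)"
    and U: "\<And>i::nat. U i \<in> borel_measurable (jump_pair_space S)" and inc: "incseq U"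
  shows "jump_op (\<lambda>p. SUP i. U i p) p = (SUP i. jump_op (U i) p)" "incseq (\<lambda>i. jump_op (U i) p)"
proof -
  obtain s z where pz: "p = (s, z)" "z = None \<or> (\<exists>x\<in>S. z = Some x)" using p by (auto simp: space_JP)
  have inc0: "incseq (\<lambda>i. U i (\<infinity>, None))" using inc by (auto simp: incseq_def le_fun_def)
  have inc1: "incseq (\<lambda>i. c * U i (\<infinity>, None))" for c :: ennreal using inc0 by (auto simp: incseq_def intro: mult_left_mono)
  show "jump_op (\<lambda>p. SUP i. U i p) p = (SUP i. jump_op (U i) p)"
    using pz density_op_SUP(1)[OF _ U inc] density_op_SUP(2)[OF _ U inc] inc1
    by (auto simp: jump_op_def pair_lift_def SUP_mult_left_ennreal ennreal_SUP_add)
  show "incseq (\<lambda>i. jump_op (U i) p)"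
    using pz density_op_SUP(2)[OF _ U inc] inc1 inc0
    by (auto simp: jump_op_def pair_lift_def incseq_def intro!: add_mono)
qed

lemma jump_op_cong:
  assumes "\<And>p. p \<in> space (jump_pair_space S) \<Longrightarrow> f p = g p" "p \<in> space (jump_pair_space S)"
  shows "jump_op f p = jump_op g p"
proof -
  have "f (\<tau>, Some y) = g (\<tau>, Some y)" if "y \<in> S" for \<tau> y
    by (rule assms(1)) (use that in \<open>simp add: space_JP\<close>)
  hence "(\<integral>\<^sup>+y. f (\<tau>, Some y) \<partial>qtilde S q x) = (\<integral>\<^sup>+y. g (\<tau>, Some y) \<partial>qtilde S q x)" for \<tau> x
    by (intro nn_integral_cong) simp
  hence 1: "density_op f s x = density_op g s x" for s x
    unfolding density_op_def by presburger
  have 2: "f (\<infinity>, None) = g (\<infinity>, None)" by (rule assms(1)) (simp add: space_JP)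
  show ?thesis unfolding jump_op_def 1 2 ..
qed

context
  fixes x0 :: 'a and M :: "'w measure" and T Z X
  assumes P: "pure_jump_process S q x0 M T Z X" and x0S: "x0 \<in> S"
begin

interpretation prob_space M using P by (simp add: pure_jump_process_def)

abbreviation "jpair n \<omega> \<equiv> (T n \<omega>, Z n \<omega>)"

lemma N_meas [measurable]: "(\<lambda>\<omega>. jpair n \<omega>) \<in> M \<rightarrow>\<^sub>M jump_pair_space S"
  using P by (auto simp: jump_pair_space_def pure_jump_process_def intro: measurable_Pair)

lemma T_meas [measurable]: "T n \<in> borel_measurable M" and Z_meas [measurable]: "Z n \<in> M \<rightarrow>\<^sub>M cemetery_space S"
  using P by (auto simp: pure_jump_process_def)

lemma hist: "(\<lambda>\<omega>. \<lambda>i\<in>{..n}. jpair i \<omega>) \<in> M \<rightarrow>\<^sub>M Pi\<^sub>M {..n} (\<lambda>_. jump_pair_space S)"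
  by (rule measurable_restrict) (rule N_meas)

lemma hist_subalg: "subalgebra M (jump_history S M T Z n)"
  unfolding subalgebra_def jump_history_def
  using measurable_sets[OF hist] measurable_space[OF hist]
  by (auto simp: sets_vimage_algebra2 Pi_iff)

lemma N_hist: "(\<lambda>\<omega>. jpair n \<omega>) \<in> jump_history S M T Z n \<rightarrow>\<^sub>M jump_pair_space S"
proof -
  have "(\<lambda>\<omega>. \<lambda>i\<in>{..n}. jpair i \<omega>) \<in> jump_history S M T Z n \<rightarrow>\<^sub>M Pi\<^sub>M {..n} (\<lambda>_. jump_pair_space S)"
    unfolding jump_history_def
    by (rule measurable_vimage_algebra1) (use measurable_space[OF hist] in auto)
  hence "(\<lambda>\<omega>. (\<lambda>i\<in>{..n}. jpair i \<omega>) n) \<in> jump_history S M T Z n \<rightarrow>\<^sub>M jump_pair_space S"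
    by (rule measurable_compose[OF _ measurable_component_singleton]) simp
  thus ?thesis by simp
qed

lemma jump_step:
  assumes phi: "\<phi> \<in> borel_measurable (jump_pair_space S)" and f: "f \<in> borel_measurable (jump_pair_space S)"
  shows "(\<integral>\<^sup>+\<omega>. \<phi> (jpair n \<omega>) * f (jpair (Suc n) \<omega>) \<partial>M) = (\<integral>\<^sup>+\<omega>. \<phi> (jpair n \<omega>) * jump_op f (jpair n \<omega>) \<partial>M)"
  using f
proof (induction rule: borel_measurable_induct)
  case (cong f g)
  have "jpair n \<omega> \<in> space (jump_pair_space S)" if "\<omega> \<in> space M" for n \<omega>
    using measurable_space[OF N_meas that] .
  hence "(\<integral>\<^sup>+\<omega>. \<phi> (jpair n \<omega>) * f (jpair (Suc n) \<omega>) \<partial>M) = (\<integral>\<^sup>+\<omega>. \<phi> (jpair n \<omega>) * g (jpair (Suc n) \<omega>) \<partial>M)"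
    "(\<integral>\<^sup>+\<omega>. \<phi> (jpair n \<omega>) * jump_op f (jpair n \<omega>) \<partial>M) = (\<integral>\<^sup>+\<omega>. \<phi> (jpair n \<omega>) * jump_op g (jpair n \<omega>) \<partial>M)"
    using cong(3) jump_op_cong[of f g] by (auto intro!: nn_integral_cong)
  thus ?case using cong(4) by simp
next
  case (set B)
  interpret finite_measure_subalgebra M "jump_history S M T Z n"
    by unfold_locales (rule hist_subalg)
  have "(\<lambda>\<omega>. indicator B (jpair (Suc n) \<omega>) :: ennreal) \<in> borel_measurable M"
    using set by measurable
  hence "(\<integral>\<^sup>+\<omega>. \<phi> (jpair n \<omega>) * indicator B (jpair (Suc n) \<omega>) \<partial>M) =
     (\<integral>\<^sup>+\<omega>. \<phi> (jpair n \<omega>) * nn_cond_exp M (jump_history S M T Z n) (\<lambda>\<omega>. indicator B (jpair (Suc n) \<omega>)) \<omega> \<partial>M)"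
    using measurable_compose[OF N_hist phi] by (intro nn_cond_exp_intg[symmetric])
  also have "\<dots> = (\<integral>\<^sup>+\<omega>. \<phi> (jpair n \<omega>) * jump_op (indicator B) (jpair n \<omega>) \<partial>M)"
  proof (rule nn_integral_cong_AE)
    have "AE \<omega> in M. nn_cond_exp M (jump_history S M T Z n) (\<lambda>\<omega>'. indicator B (jpair (Suc n) \<omega>')) \<omega> = next_jump S q (jpair n \<omega>) B"
      using P set by (simp add: pure_jump_process_def)
    thus "AE \<omega> in M. \<phi> (jpair n \<omega>) * nn_cond_exp M (jump_history S M T Z n) (\<lambda>\<omega>. indicator B (jpair (Suc n) \<omega>)) \<omega>
        = \<phi> (jpair n \<omega>) * jump_op (indicator B) (jpair n \<omega>)"
      by eventually_elim (simp add: jump_op_indicator)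
  qed
  finally show ?case .
next
  case (mult u c)
  note [measurable] = phi mult(2) jump_op_measurable[OF mult(2)]
  have "(\<integral>\<^sup>+\<omega>. \<phi> (jpair n \<omega>) * (c * u (jpair (Suc n) \<omega>)) \<partial>M) = c * (\<integral>\<^sup>+\<omega>. \<phi> (jpair n \<omega>) * u (jpair (Suc n) \<omega>) \<partial>M)"
    by (subst nn_integral_cmult[symmetric]) (measurable, simp add: mult.left_commute)
  also have "\<dots> = (\<integral>\<^sup>+\<omega>. c * (\<phi> (jpair n \<omega>) * jump_op u (jpair n \<omega>)) \<partial>M)"
    unfolding mult.IH by (subst nn_integral_cmult) (measurable)
  also have "\<dots> = (\<integral>\<^sup>+\<omega>. \<phi> (jpair n \<omega>) * jump_op (\<lambda>p. c * u p) (jpair n \<omega>) \<partial>M)"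
    using jump_op_cmult[OF measurable_space[OF N_meas] mult(2)]
    by (intro nn_integral_cong) (simp add: mult.left_commute)
  finally show ?case .
next
  case (add u v)
  note [measurable] = phi add(1,3) jump_op_measurable[OF add(1)] jump_op_measurable[OF add(3)]
  have "(\<integral>\<^sup>+\<omega>. \<phi> (jpair n \<omega>) * (v (jpair (Suc n) \<omega>) + u (jpair (Suc n) \<omega>)) \<partial>M) =
      (\<integral>\<^sup>+\<omega>. \<phi> (jpair n \<omega>) * v (jpair (Suc n) \<omega>) \<partial>M) + (\<integral>\<^sup>+\<omega>. \<phi> (jpair n \<omega>) * u (jpair (Suc n) \<omega>) \<partial>M)"
    unfolding distrib_left by (rule nn_integral_add) measurable
  also have "\<dots> = (\<integral>\<^sup>+\<omega>. \<phi> (jpair n \<omega>) * jump_op v (jpair n \<omega>) + \<phi> (jpair n \<omega>) * jump_op u (jpair n \<omega>) \<partial>M)"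
    unfolding add.IH by (rule nn_integral_add[symmetric]) measurable
  also have "\<dots> = (\<integral>\<^sup>+\<omega>. \<phi> (jpair n \<omega>) * jump_op (\<lambda>p. v p + u p) (jpair n \<omega>) \<partial>M)"
    using jump_op_add[OF measurable_space[OF N_meas] add(3,1)]
    by (intro nn_integral_cong) (simp add: distrib_left)
  finally show ?case by simp
next
  case (seq U)
  note [measurable] = phi seq(1) jump_op_measurable[OF seq(1)]
  have SUPf: "(SUP i. U i) = (\<lambda>p. SUP i. U i p)" by (auto simp: fun_eq_iff image_comp)
  have inc: "U i p \<le> U j p" if "i \<le> j" for i j p using incseqD[OF seq(3) that] by (rule le_funD)
  have jinc: "incseq (\<lambda>i. jump_op (U i) (jpair n \<omega>))" if "\<omega> \<in> space M" for \<omega>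
    using jump_op_SUP(2)[OF measurable_space[OF N_meas that] seq(1,3)] .
  have "(\<integral>\<^sup>+\<omega>. \<phi> (jpair n \<omega>) * (SUP i. U i (jpair (Suc n) \<omega>)) \<partial>M) =
      (SUP i. \<integral>\<^sup>+\<omega>. \<phi> (jpair n \<omega>) * U i (jpair (Suc n) \<omega>) \<partial>M)"
    unfolding SUP_mult_left_ennreal
    by (rule nn_integral_monotone_convergence_SUP)
       (auto simp: incseq_def le_fun_def intro!: mult_left_mono inc)
  also have "\<dots> = (SUP i. \<integral>\<^sup>+\<omega>. \<phi> (jpair n \<omega>) * jump_op (U i) (jpair n \<omega>) \<partial>M)"
    using seq by simp
  also have "\<dots> = (\<integral>\<^sup>+\<omega>. (SUP i. \<phi> (jpair n \<omega>) * jump_op (U i) (jpair n \<omega>)) \<partial>M)"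
    by (rule nn_integral_monotone_convergence_SUP_AE[symmetric])
       (use jinc in \<open>auto simp: incseq_def intro!: mult_left_mono AE_I2\<close>)
  also have "\<dots> = (\<integral>\<^sup>+\<omega>. \<phi> (jpair n \<omega>) * jump_op (\<lambda>p. SUP i. U i p) (jpair n \<omega>) \<partial>M)"
    using jump_op_SUP(1)[OF measurable_space[OF N_meas] seq(1,3)]
    by (intro nn_integral_cong) (simp add: SUP_mult_left_ennreal)
  finally show ?case unfolding SUPf .
qed

lemma AE_T_mono: "AE \<omega> in M. T n \<omega> \<le> T (Suc n) \<omega>"
proof -
  have "AE \<omega> in M. \<not> (ennreal (of_rat r) \<le> T n \<omega> \<and> T (Suc n) \<omega> < ennreal (of_rat r))" for r :: rat
  proof -
    let ?c = "ennreal (of_rat r)"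
    have 1: "(\<lambda>p. indicator {?c..} (fst p) :: ennreal) \<in> borel_measurable (jump_pair_space S)"
      "(\<lambda>p. indicator {..<?c} (fst p) :: ennreal) \<in> borel_measurable (jump_pair_space S)"
      unfolding jump_pair_space_def by measurable
    have z: "indicator {?c..} (fst p) * jump_op (\<lambda>p. indicator {..<?c} (fst p)) p = 0" for p
    proof (cases "fst p < ?c")
      case False
      have "density_op (\<lambda>p. indicator {..<?c} (fst p)) (enn2real (fst p)) x = 0" if "fst p \<noteq> \<infinity>" for x
      proof -
        have "\<not> ennreal u < ?c" if "enn2real (fst p) < u" for u
        proof -
          have "ennreal (enn2real (fst p)) \<le> ennreal u" using that by (intro ennreal_leI) simp
          moreover have "ennreal (enn2real (fst p)) = fst p" using \<open>fst p \<noteq> \<infinity>\<close> by (simp add: less_top)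
          ultimately show ?thesis using False by simp
        qed
        hence "(\<lambda>u. ennreal (exp (- qrate q x * (u - enn2real (fst p)))) *
          (\<integral>\<^sup>+y. indicator {..<?c} (fst (ennreal u, Some y)) \<partial>qtilde S q x) * indicator {enn2real (fst p)<..} u) = (\<lambda>_. 0)"
          by (auto simp: fun_eq_iff indicator_def)
        thus ?thesis unfolding density_op_def by (simp only: nn_integral_const) simp
      qed
      thus ?thesis by (auto simp: jump_op_def pair_lift_def split: option.splits)
    qed (auto simp: indicator_def)
    have "(\<integral>\<^sup>+\<omega>. indicator {?c..} (fst (jpair n \<omega>)) * indicator {..<?c} (fst (jpair (Suc n) \<omega>)) \<partial>M) = 0"
      using jump_step[OF 1, of n] unfolding z by simp
    hence "AE \<omega> in M. indicator {?c..} (T n \<omega>) * (indicator {..<?c} (T (Suc n) \<omega>) :: ennreal) = 0"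
      by (subst (asm) nn_integral_0_iff_AE) auto
    thus ?thesis by eventually_elim (auto simp: indicator_def split: if_splits)
  qed
  hence "AE \<omega> in M. \<forall>r. \<not> (ennreal (of_rat r) \<le> T n \<omega> \<and> T (Suc n) \<omega> < ennreal (of_rat r))"
    by (simp add: AE_all_countable)
  thus ?thesis
  proof eventually_elim
    case (elim \<omega>)
    show ?case
    proof (rule ccontr)
      assume "\<not> T n \<omega> \<le> T (Suc n) \<omega>"
      hence "T (Suc n) \<omega> < T n \<omega>" by simp
      from ennreal_rat_dense[OF this] obtain r :: rat where
        "T (Suc n) \<omega> < ennreal (of_rat r)" "ennreal (of_rat r) < T n \<omega>" by blast
      thus False using elim by (auto intro: less_imp_le)
    qed
  qed
qed

end

lemma exp_tail:
  assumes r: "0 \<le> r" 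
  shows "(\<integral>\<^sup>+u\<in>{a<..}. ennreal (exp (- r * (u - s))) * ennreal r \<partial>lborel) =
    (if r = 0 then 0 else ennreal (exp (- r * (a - s))))"
proof (cases "r = 0")
  case False
  hence r: "0 < r" using r by simp
  have "(\<integral>\<^sup>+u\<in>{a<..}. ennreal (exp (- r * (u - s))) * ennreal r \<partial>lborel) =
     (\<integral>\<^sup>+u. ennreal (r * exp (- r * (u - s))) * indicator {a..} u \<partial>lborel)"
  proof (rule nn_integral_cong_AE)
    show "AE u in lborel. ennreal (exp (- r * (u - s))) * ennreal r * indicator {a<..} u =
      ennreal (r * exp (- r * (u - s))) * indicator {a..} u"
      using AE_lborel_singleton[of a]
    proof eventually_elim
      case (elim u)
      thus ?case using r by (auto simp: indicator_def ennreal_mult mult.commute)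
    qed
  qed
  also have "\<dots> = ennreal (0 - (- exp (- r * (a - s))))"
  proof (rule nn_integral_FTC_atLeast)
    show "((\<lambda>u. - exp (- r * (u - s))) \<longlongrightarrow> 0) at_top"
    proof -
      have "filterlim (\<lambda>u::real. - s + u) at_top at_top"
        by (rule filterlim_tendsto_add_at_top[OF tendsto_const filterlim_ident])
      hence "filterlim (\<lambda>u. r * (- s + u)) at_top at_top"
        by (rule filterlim_tendsto_pos_mult_at_top[OF tendsto_const r])
      hence "filterlim (\<lambda>u. r * (u - s)) at_top at_top"
        by (simp only: add.commute[of "- s"] add_uminus_conv_diff)
      hence "((\<lambda>u. exp (- (r * (u - s)))) \<longlongrightarrow> 0) at_top"
        by (intro filterlim_compose[OF exp_at_bot]) (simp only: filterlim_uminus_at_top[symmetric])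
      from tendsto_minus[OF this] show ?thesis by simp
    qed
  qed (use r in \<open>auto intro!: derivative_eq_intros\<close>)
  finally show ?thesis using False by simp
qed simp

lemma Pq_iter_measurable:
  assumes G: "G \<in> sets borelS"
  shows "(\<lambda>(s, x). Pq_iter n S q s x t G) \<in> borel_measurable (borel \<Otimes>\<^sub>M borelS)"
proof (induction n)
  case 0
  note [measurable] = measurable_qrate G
  show ?case by simp
next
  case (Suc n)
  note [measurable] = measurable_qrate Suc
  have [measurable]: "(\<lambda>w. \<integral>\<^sup>+z. Pq_iter n S q (snd w) z t G \<partial>qtilde S q (snd (fst w)))
      \<in> borel_measurable ((borel \<Otimes>\<^sub>M borelS) \<Otimes>\<^sub>M lborel)"
    by (rule nn_integral_qtilde_measurable) measurable
  have "(\<lambda>p. \<integral>\<^sup>+u. ennreal (exp (- qrate q (snd p) * (u - fst p))) *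
        (\<lambda>w. \<integral>\<^sup>+z. Pq_iter n S q (snd w) z t G \<partial>qtilde S q (snd (fst w))) (p, u) *
          indicator {u. fst p \<le> u \<and> u \<le> t} u \<partial>lborel)
     \<in> borel_measurable (borel \<Otimes>\<^sub>M borelS)"
    by (rule lborel.borel_measurable_nn_integral) (unfold split_beta, measurable)
  moreover have "{u. a \<le> u \<and> u \<le> t} = {a..t}" for a by auto
  ultimately show ?case by (simp add: split_beta)
qed


definition Pq_trunc :: "real \<Rightarrow> 'a set \<Rightarrow> nat \<Rightarrow> real \<Rightarrow> 'a \<Rightarrow> ennreal" where
  "Pq_trunc t G n s x = (if s \<le> t then Pq_iter n S q s x t G else 0)"

lemma Pq_trunc_measurable:
  assumes G: "G \<in> sets borelS"
  shows "(\<lambda>(s, x). Pq_trunc t G n s x) \<in> borel_measurable (borel \<Otimes>\<^sub>M borelS)"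
proof -
  note [measurable] = Pq_iter_measurable[OF G, of n t]
  show ?thesis unfolding Pq_trunc_def split_beta by measurable
qed

lemma jump_op_Pq_trunc:
  assumes p: "p \<in> space (jump_pair_space S)"
  shows "jump_op (pair_lift (Pq_trunc t G n) 0) p = pair_lift (Pq_trunc t G (Suc n)) 0 p"
proof -
  have "density_op (pair_lift (Pq_trunc t G n) 0) s x = Pq_trunc t G (Suc n) s x" if s: "0 \<le> s" for s x
  proof -
    have "density_op (pair_lift (Pq_trunc t G n) 0) s x = (\<integral>\<^sup>+u. ennreal (exp (- qrate q x * (u - s))) *
        (\<integral>\<^sup>+y. Pq_iter n S q u y t G \<partial>qtilde S q x) * indicator {s<..t} u \<partial>lborel)"
      unfolding density_op_def
    proof (rule nn_integral_cong)
      fix u :: real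
      show "ennreal (exp (- qrate q x * (u - s))) *
         (\<integral>\<^sup>+y. pair_lift (Pq_trunc t G n) 0 (ennreal u, Some y) \<partial>qtilde S q x) * indicator {s<..} u =
        ennreal (exp (- qrate q x * (u - s))) *
        (\<integral>\<^sup>+y. Pq_iter n S q u y t G \<partial>qtilde S q x) * indicator {s<..t} u"
      proof (cases "s < u")
        case True
        hence "pair_lift (Pq_trunc t G n) 0 (ennreal u, Some y) = Pq_trunc t G n u y" for y
          using s by (simp add: pair_lift_def)
        thus ?thesis using True by (cases "u \<le> t") (simp_all add: Pq_trunc_def)
      qed simp
    qed
    also have "\<dots> = Pq_trunc t G (Suc n) s x"
    proof (cases "s \<le> t")
      case True
      have "AE u in lborel. ennreal (exp (- qrate q x * (u - s))) *
          (\<integral>\<^sup>+y. Pq_iter n S q u y t G \<partial>qtilde S q x) * indicator {s<..t} u =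
         ennreal (exp (- qrate q x * (u - s))) *
          (\<integral>\<^sup>+y. Pq_iter n S q u y t G \<partial>qtilde S q x) * indicator {s..t} u"
        using AE_lborel_singleton[of s]
      proof eventually_elim
        case (elim u)
        hence "indicator {s<..t} u = (indicator {s..t} u :: ennreal)" by (auto simp: indicator_def)
        thus ?case by simp
      qed
      from nn_integral_cong_AE[OF this] show ?thesis using True by (simp add: Pq_trunc_def)
    next
      case False
      hence "{s<..t} = {}" by simp
      thus ?thesis using False by (simp add: Pq_trunc_def)
    qed
    finally show ?thesis .
  qed
  thus ?thesis by (simp add: jump_op_def pair_lift_def split: option.splits)
qed

lemma survival:
  assumes x: "x \<in> S" and s: "0 \<le> s" "s \<le> t" and t: "0 \<le> t"
  shows "density_op (\<lambda>p. indicator {ennreal t<..} (fst p)) s x + (1 - jump_density_part S q s x UNIV) =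
    ennreal (exp (- qrate q x * (t - s)))"
proof -
  note r = qrate_nonneg[OF x]
  have "density_op (\<lambda>p. indicator {ennreal t<..} (fst p)) s x =
     (\<integral>\<^sup>+u\<in>{t<..}. ennreal (exp (- qrate q x * (u - s))) * ennreal (qrate q x) \<partial>lborel)"
    unfolding density_op_def
  proof (rule nn_integral_cong)
    fix u :: real
    have "ennreal t < ennreal u \<longleftrightarrow> t < u" using t ennreal_less_iff[of t u] by simp
    thus "ennreal (exp (- qrate q x * (u - s))) *
         (\<integral>\<^sup>+y. indicator {ennreal t<..} (fst (ennreal u, Some y)) \<partial>qtilde S q x) * indicator {s<..} u =
      ennreal (exp (- qrate q x * (u - s))) * ennreal (qrate q x) * indicator {t<..} u"
      using s by (auto simp: indicator_def emeasure_qtilde_S[OF x])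
  qed
  also have "\<dots> = (if qrate q x = 0 then 0 else ennreal (exp (- qrate q x * (t - s))))"
    by (rule exp_tail[OF r])
  finally have 1: "density_op (\<lambda>p. indicator {ennreal t<..} (fst p)) s x = \<dots>" .
  have "jump_density_part S q s x UNIV =
     (\<integral>\<^sup>+u\<in>{s<..}. ennreal (exp (- qrate q x * (u - s))) * ennreal (qrate q x) \<partial>lborel)"
    unfolding jump_density_part_def by (simp add: emeasure_qtilde_S[OF x])
  also have "\<dots> = (if qrate q x = 0 then 0 else ennreal (exp (- qrate q x * (s - s))))"
    by (rule exp_tail[OF r])
  finally have 2: "jump_density_part S q s x UNIV = (if qrate q x = 0 then 0 else 1)" by simp
  show ?thesis unfolding 1 2 by simp
qed

lemma pure_jump_process_law:
  fixes M :: "'w measure"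
  assumes P: "pure_jump_process S q x0 M T Z X" and x0S: "x0 \<in> S"
    and G: "G \<in> sets borelS" and t: "0 \<le> t"
  shows "emeasure M {\<omega> \<in> space M. X t \<omega> \<in> Some ` G} = Pq S q 0 x0 t G"
proof -
  note Pd = P[unfolded pure_jump_process_def]
  have ps: "prob_space M" using Pd by blast
  interpret prob_space M by (rule ps)
  let ?N = "\<lambda>n \<omega>. (T n \<omega>, Z n \<omega>)"
  note [measurable] = N_meas[OF P x0S] T_meas[OF P x0S] Z_meas[OF P x0S]
  have Nsp: "?N n \<omega> \<in> space (jump_pair_space S)" if "\<omega> \<in> space M" for n \<omega>
    using measurable_space[OF N_meas[OF P x0S] that] .
  have GS: "G \<subseteq> S" using sets.sets_into_space[OF G] space_BS by simp
  have SG [measurable]: "Some ` G \<in> sets (cemetery_space S)" by (rule Some_image_sets[OF G])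
  have gm: "pair_lift (Pq_trunc t G m) 0 \<in> borel_measurable (jump_pair_space S)" for m
    by (rule measurable_pair_lift[OF Pq_trunc_measurable[OF G]])
  have W: "(\<integral>\<^sup>+\<omega>. pair_lift (Pq_trunc t G m) 0 (?N n \<omega>) \<partial>M) = Pq_iter (n + m) S q 0 x0 t G" for n m
  proof (induction n arbitrary: m)
    case 0
    have "AE \<omega> in M. pair_lift (Pq_trunc t G m) 0 (?N 0 \<omega>) = Pq_iter m S q 0 x0 t G"
    proof -
      have "AE \<omega> in M. T 0 \<omega> = 0 \<and> Z 0 \<omega> = Some x0" using Pd by blast
      thus ?thesis by eventually_elim (simp add: pair_lift_def Pq_trunc_def t)
    qed
    hence "(\<integral>\<^sup>+\<omega>. pair_lift (Pq_trunc t G m) 0 (?N 0 \<omega>) \<partial>M) = (\<integral>\<^sup>+\<omega>. Pq_iter m S q 0 x0 t G \<partial>M)"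
      by (rule nn_integral_cong_AE)
    thus ?case by (simp add: emeasure_space_1)
  next
    case (Suc n)
    have "(\<integral>\<^sup>+\<omega>. pair_lift (Pq_trunc t G m) 0 (?N (Suc n) \<omega>) \<partial>M) = (\<integral>\<^sup>+\<omega>. jump_op (pair_lift (Pq_trunc t G m) 0) (?N n \<omega>) \<partial>M)"
      using jump_step[OF P x0S borel_measurable_const[of 1] gm, of m n] by simp
    also have "\<dots> = (\<integral>\<^sup>+\<omega>. pair_lift (Pq_trunc t G (Suc m)) 0 (?N n \<omega>) \<partial>M)"
      by (intro nn_integral_cong jump_op_Pq_trunc Nsp)
    also have "\<dots> = Pq_iter (n + Suc m) S q 0 x0 t G" by (rule Suc.IH)
    finally show ?case by simp
  qed
  define \<phi> :: "ennreal \<times> 'a option \<Rightarrow> ennreal" where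
    "\<phi> = (\<lambda>p. indicator {..ennreal t} (fst p) * indicator (Some ` G) (snd p))"
  define f :: "ennreal \<times> 'a option \<Rightarrow> ennreal" where "f = (\<lambda>p. indicator {ennreal t<..} (fst p))"
  have \<phi>m: "\<phi> \<in> borel_measurable (jump_pair_space S)" and fm: "f \<in> borel_measurable (jump_pair_space S)"
    unfolding jump_pair_space_def \<phi>_def f_def by measurable
  have step: "(\<integral>\<^sup>+\<omega>. \<phi> (?N n \<omega>) * f (?N (Suc n) \<omega>) \<partial>M) = Pq_iter n S q 0 x0 t G" for n
  proof -
    have "\<phi> p * jump_op f p = pair_lift (Pq_trunc t G 0) 0 p" if p: "p \<in> space (jump_pair_space S)" for p
    proof -
      obtain s z where pz: "p = (s, z)" by (cases p)
      show ?thesis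
      proof (cases "s \<le> ennreal t \<and> z \<in> Some ` G")
        case True
        then obtain y where y: "y \<in> G" "z = Some y" by auto
        hence yS: "y \<in> S" using GS by auto
        have sfin: "s \<noteq> \<infinity>" using True by (auto simp: top_unique)
        have st: "enn2real s \<le> t" using True t by (metis enn2real_ennreal enn2real_mono ennreal_less_top)
        have "jump_op f p = ennreal (exp (- qrate q y * (t - enn2real s)))"
          using survival[OF yS _ st t] sfin
          by (simp add: jump_op_def pair_lift_def pz y f_def)
        thus ?thesis using True y sfin st by (simp add: \<phi>_def pz pair_lift_def Pq_trunc_def)
      next
        case False
        have "pair_lift (Pq_trunc t G 0) 0 p = 0"
        proof (cases "s = \<infinity> \<or> z = None")
          case f: False
          then obtain y where y: "z = Some y" by auto
          have "enn2real s \<le> t \<Longrightarrow> s \<le> ennreal t"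
            using f by (metis ennreal_enn2real ennreal_leI infinity_ennreal_def less_top)
          hence "enn2real s \<le> t \<Longrightarrow> y \<notin> G" using False y by auto
          thus ?thesis using f y by (auto simp: pair_lift_def pz Pq_trunc_def)
        qed (auto simp: pair_lift_def pz)
        thus ?thesis using False by (auto simp: \<phi>_def pz indicator_def)
      qed
    qed
    hence "(\<integral>\<^sup>+\<omega>. \<phi> (?N n \<omega>) * jump_op f (?N n \<omega>) \<partial>M) = (\<integral>\<^sup>+\<omega>. pair_lift (Pq_trunc t G 0) 0 (?N n \<omega>) \<partial>M)"
      by (intro nn_integral_cong) (simp add: Nsp)
    thus ?thesis using jump_step[OF P x0S \<phi>m fm, of n] W[of 0 n] by simp
  qed
  have AE_eq: "AE \<omega> in M. indicator {\<omega> \<in> space M. X t \<omega> \<in> Some ` G} \<omega> = (\<Sum>n. \<phi> (?N n \<omega>) * f (?N (Suc n) \<omega>))"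
  proof -
    have 1: "AE \<omega> in M. T 0 \<omega> = 0 \<and> Z 0 \<omega> = Some x0" using Pd by blast
    have 2: "AE \<omega> in M. \<forall>n. T n \<omega> \<le> T (Suc n) \<omega>"
      using AE_T_mono[OF P x0S] by (simp add: AE_all_countable)
    have 3: "AE \<omega> in M. \<forall>t\<ge>0. (\<forall>n. T n \<omega> \<le> ennreal t \<and> ennreal t < T (Suc n) \<omega> \<longrightarrow> X t \<omega> = Z n \<omega>) \<and>
        (lim (\<lambda>n. T n \<omega>) \<le> ennreal t \<longrightarrow> X t \<omega> = None)" using Pd by blast
    show ?thesis using 1 2 3 AE_space
    proof eventually_elim
      case (elim \<omega>)
      have inc: "incseq (\<lambda>n. T n \<omega>)" using elim(2) by (intro incseq_SucI) auto
      show ?case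
      proof (cases "\<exists>n. T n \<omega> \<le> ennreal t \<and> ennreal t < T (Suc n) \<omega>")
        case True
        then obtain n where n: "T n \<omega> \<le> ennreal t" "ennreal t < T (Suc n) \<omega>" by blast
        have z: "\<phi> (?N m \<omega>) * f (?N (Suc m) \<omega>) = 0" if "m \<noteq> n" for m
        proof (cases "m < n")
          case True
          hence "T (Suc m) \<omega> \<le> T n \<omega>" using incseqD[OF inc, of "Suc m" n] by simp
          hence "\<not> ennreal t < T (Suc m) \<omega>" using n(1) by auto
          thus ?thesis by (simp add: f_def)
        next
          case False
          hence "T (Suc n) \<omega> \<le> T m \<omega>" using that incseqD[OF inc, of "Suc n" m] by simp
          hence "\<not> T m \<omega> \<le> ennreal t" using n(2) by auto
          thus ?thesis by (simp add: \<phi>_def)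
        qed
        have "(\<Sum>m. \<phi> (?N m \<omega>) * f (?N (Suc m) \<omega>)) = (\<Sum>m\<in>{n}. \<phi> (?N m \<omega>) * f (?N (Suc m) \<omega>))"
          by (rule suminf_finite) (use z in auto)
        also have "\<dots> = indicator (Some ` G) (Z n \<omega>)" using n by (simp add: \<phi>_def f_def)
        also have "Z n \<omega> = X t \<omega>" using elim(3) t n by auto
        finally show ?thesis using elim(4) by (auto simp: indicator_def)
      next
        case False
        have le: "T n \<omega> \<le> ennreal t" for n
        proof (induction n)
          case 0 thus ?case using elim(1) by simp
        next
          case (Suc n) thus ?case using False by (meson not_le)
        qed
        have "(\<lambda>n. T n \<omega>) \<longlonglongrightarrow> (SUP n. T n \<omega>)" by (rule LIMSEQ_SUP[OF inc])
        hence "lim (\<lambda>n. T n \<omega>) = (SUP n. T n \<omega>)" by (rule limI)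
        hence "lim (\<lambda>n. T n \<omega>) \<le> ennreal t" using le by (simp add: SUP_least)
        hence "X t \<omega> = None" using elim(3) t by blast
        moreover have "(\<lambda>n. \<phi> (?N n \<omega>) * f (?N (Suc n) \<omega>)) = (\<lambda>_. 0)"
        proof (rule ext)
          fix n have "\<not> ennreal t < T (Suc n) \<omega>" using le[of "Suc n"] by auto
          thus "\<phi> (?N n \<omega>) * f (?N (Suc n) \<omega>) = 0" by (simp add: f_def)
        qed
        ultimately show ?thesis by (auto simp: indicator_def)
      qed
    qed
  qed
  have [measurable]: "X t \<in> M \<rightarrow>\<^sub>M cemetery_space S" using Pd t by blast
  have "emeasure M {\<omega> \<in> space M. X t \<omega> \<in> Some ` G} =
      (\<integral>\<^sup>+\<omega>. indicator {\<omega> \<in> space M. X t \<omega> \<in> Some ` G} \<omega> \<partial>M)"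
    by (rule nn_integral_indicator[symmetric]) measurable
  also have "\<dots> = (\<integral>\<^sup>+\<omega>. (\<Sum>n. \<phi> (?N n \<omega>) * f (?N (Suc n) \<omega>)) \<partial>M)"
    by (rule nn_integral_cong_AE[OF AE_eq])
  also have "\<dots> = (\<Sum>n. \<integral>\<^sup>+\<omega>. \<phi> (?N n \<omega>) * f (?N (Suc n) \<omega>) \<partial>M)"
  proof (rule nn_integral_suminf)
    fix n
    note [measurable] = \<phi>m fm
    show "(\<lambda>\<omega>. \<phi> (?N n \<omega>) * f (?N (Suc n) \<omega>)) \<in> borel_measurable M" by measurable
  qed
  finally show ?thesis unfolding step Pq_def .
qed

end

end

theory Submission
  imports Defs
begin

text \<open>
  For \<open>\<alpha> > 0\<close> put \<open>R f x = (\<alpha> + q\<^sub>x)\<^sup>-\<^sup>1 \<integral> f(y) q~(dy|x)\<close>.  Integrating out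
  one jump at a time gives \<open>E\<^sub>x exp(-\<alpha> t\<^sub>n) = (R\<^sup>n 1)(x)\<close>, so \<open>u(x) = E\<^sub>x exp(-\<alpha> t\<^sub>\<infinity>)\<close> is the
  decreasing limit of \<open>R\<^sup>n 1\<close>; it is the largest \<open>[0,1]\<close>-valued \<open>U\<close> with \<open>U \<le> R U\<close>, it satisfies
  \<open>u = R u\<close>, and it vanishes exactly when there is no explosion.  This is (c) and (d), because
  \<open>\<alpha> U \<le> \<integral> U dq\<close> means \<open>U \<le> R U\<close>.

  For (a), \<open>h = u - \<epsilon> V\<close> satisfies \<open>h \<le> R h\<close> and is nonpositive off some \<open>S\<^sub>n\<close>, while on \<open>S\<^sub>n\<close> the
  operator \<open>R\<close> contracts the supremum because the rates are bounded there; hence \<open>h \<le> 0\<close> for every \<open>\<epsilon>\<close>.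

  For (b), take compact \<open>K\<^sub>m \<up> S\<close> and continuous cutoffs \<open>\<phi>\<^sub>m\<close>, 0 on \<open>K\<^sub>m\<close> and 1 off \<open>K\<^sub>m\<^sub>+\<^sub>1\<close>, and
  put \<open>w\<^sub>0 = 1\<close>, \<open>w\<^sub>m\<^sub>+\<^sub>1 = \<phi>\<^sub>m + (1 - \<phi>\<^sub>m) R w\<^sub>m\<close>.  These functions are continuous and decrease
  with \<open>R w\<^sub>m \<le> w\<^sub>m\<close> to a fixed point of \<open>R\<close>, hence to 0, uniformly on compacts by Dini's theorem.
  Since \<open>w\<^sub>m = 1\<close> off \<open>K\<^sub>m\<close>, a sum \<open>V\<close> of a fast subsequence of them is as required.
\<close>

(* With their schematic process these rules apply to every measurability goal and make
   the method measurable and the simplifier loop. *)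
declare N_meas [measurable del] T_meas [measurable del] Z_meas [measurable del]

subsection \<open>Compact exhaustions\<close>

text \<open>Take the distance to \<open>K\<close> divided by the sum of the distances to
  \<open>K\<close> and to the complement of \<open>W\<close>; the sum is positive because these two
  sets are closed and disjoint.\<close>

lemma compact_cutoff:
  fixes K W :: "'a::metric_space set"
  assumes "compact K" "open W" "K \<subseteq> W"
  obtains \<phi> :: "'a \<Rightarrow> real" where "continuous_on UNIV \<phi>" "\<And>x. 0 \<le> \<phi> x \<and> \<phi> x \<le> 1"
    "\<And>x. x \<in> K \<Longrightarrow> \<phi> x = 0" "\<And>x. x \<notin> W \<Longrightarrow> \<phi> x = 1"
proof (cases "K = {} \<or> W = UNIV")
  case True
  \<comment> \<open>\<open>infdist\<close> to the empty set is 0, so the quotient fails when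
    \<open>K\<close> or the complement of \<open>W\<close> is empty; constants serve there.\<close>
  show ?thesis by (rule that[of "\<lambda>_. if K = {} then 1 else 0"]) (use True in auto)
next
  case False
  define \<phi> where "\<phi> x = infdist x K / (infdist x K + infdist x (- W))" for x
  have "0 < infdist x K + infdist x (- W)" for x
  proof (cases "x \<in> K")
    case True
    hence "infdist x (- W) \<noteq> 0"
      using assms False in_closed_iff_infdist_zero[of "- W" x] by auto
    thus ?thesis using infdist_nonneg[of x K] infdist_nonneg[of x "- W"] by linarith
  next
    case f: False
    hence "infdist x K \<noteq> 0"
      using compact_imp_closed[OF assms(1)] False in_closed_iff_infdist_zero[of K x] by auto
    thus ?thesis using infdist_nonneg[of x K] infdist_nonneg[of x "- W"] by linarith
  qed
  note pos = this
  show ?thesis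
  proof (rule that[of \<phi>])
    show "continuous_on UNIV \<phi>"
      unfolding \<phi>_def using pos by (intro continuous_intros) (auto simp: less_le)
    show "0 \<le> \<phi> x \<and> \<phi> x \<le> 1" for x
      using pos[of x] infdist_nonneg[of x K] infdist_nonneg[of x "- W"] by (simp add: \<phi>_def)
    show "\<phi> x = 0" if "x \<in> K" for x using that by (simp add: \<phi>_def)
    show "\<phi> x = 1" if "x \<notin> W" for x
      using that pos[of x] by (simp add: \<phi>_def)
  qed
qed

text \<open>By Lindelof, countably many open \<open>w (a i)\<close> cover \<open>S\<close>, each
  with trace inside a compact \<open>c (a i)\<close>. \<open>K m\<close> unites these compacts up to
  an index \<open>N m\<close> that grows fast enough for the open sets up to
  \<open>N (Suc m)\<close> to cover \<open>K m\<close>.\<close>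

lemma locally_compact_exhaustion:
  fixes S :: "'a::{metric_space, second_countable_topology} set"
  assumes lc: "locally_compact_space (top_of_set S)" and ne: "S \<noteq> {}"
  obtains K W :: "nat \<Rightarrow> 'a set" where "\<And>n. compact (K n)" "\<And>n. open (W n)" "\<And>n. K n \<subseteq> W n"
    "\<And>n. W n \<inter> S \<subseteq> K (Suc n)" "incseq K" "(\<Union>n. K n) = S"
proof -
  have "\<exists>W C. open W \<and> x \<in> W \<and> W \<inter> S \<subseteq> C \<and> compact C \<and> C \<subseteq> S" if "x \<in> S" for x
  proof -
    obtain U C where UC: "openin (top_of_set S) U" "compactin (top_of_set S) C" "x \<in> U" "U \<subseteq> C"
      using lc \<open>x \<in> S\<close> unfolding locally_compact_space_def topspace_euclidean_subtopology by metis
    obtain W where "open W" "U = S \<inter> W" using UC(1) by (auto simp: openin_open)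
    thus ?thesis using UC by (intro exI[of _ W] exI[of _ C]) (auto simp: compactin_subtopology)
  qed
  then obtain w c where wc: "\<And>x. x \<in> S \<Longrightarrow> open (w x) \<and> x \<in> w x \<and> w x \<inter> S \<subseteq> c x \<and> compact (c x) \<and> c x \<subseteq> S"
    by metis
  obtain F where F: "F \<subseteq> w ` S" "countable F" "\<Union>F = \<Union>(w ` S)"
    using Lindelof[of "w ` S"] wc by (metis imageE)
  obtain A where A: "countable A" "A \<subseteq> S" "F = w ` A"
    using F(1,2) by (metis countable_subset_image)
  have An: "A \<noteq> {}" using ne wc F(3) A by fastforce
  define a where "a = from_nat_into A"
  have aS: "a i \<in> S" for i using from_nat_into[OF An] A(2) by (auto simp: a_def)
  have cov: "S \<subseteq> (\<Union>i. w (a i))"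
  proof
    fix x assume "x \<in> S"
    hence "x \<in> \<Union>F" using wc F(3) by blast
    then obtain y where "y \<in> A" "x \<in> w y" using A(3) by auto
    thus "x \<in> (\<Union>i. w (a i))" using from_nat_into_surj[OF A(1), of y] by (auto simp: a_def)
  qed
  have "\<exists>h. k < h \<and> (\<Union>i\<le>k. c (a i)) \<subseteq> (\<Union>i\<le>h. w (a i))" for k
  proof -
    have "compact (\<Union>i\<le>k. c (a i))" using wc aS by (intro compact_UN) auto
    moreover have "(\<Union>i\<le>k. c (a i)) \<subseteq> (\<Union>i\<in>UNIV. w (a i))" using wc aS cov by blast
    ultimately obtain D where D: "finite D" "(\<Union>i\<le>k. c (a i)) \<subseteq> (\<Union>i\<in>D. w (a i))"
      using compactE_image[of "\<Union>i\<le>k. c (a i)" UNIV "\<lambda>i. w (a i)"] wc aS by metis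
    obtain m where "\<And>i. i \<in> D \<Longrightarrow> i \<le> m" using D(1) unfolding finite_nat_set_iff_bounded_le by auto
    \<comment> \<open>\<open>Suc k\<close> forces \<open>k < h k\<close>, so \<open>N\<close> is
      unbounded and the \<open>K m\<close> exhaust \<open>S\<close>.\<close>
    hence "D \<subseteq> {..max m (Suc k)}" by fastforce
    hence "(\<Union>i\<le>k. c (a i)) \<subseteq> (\<Union>i\<le>max m (Suc k). w (a i))"
      using D(2) UN_mono[of D "{..max m (Suc k)}" "\<lambda>i. w (a i)"] by blast
    thus ?thesis by (intro exI[of _ "max m (Suc k)"]) simp
  qed
  then obtain h where h: "\<And>k. k < h k" "\<And>k. (\<Union>i\<le>k. c (a i)) \<subseteq> (\<Union>i\<le>h k. w (a i))" by metis
  define N where "N m = (h ^^ m) 0" for m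
  have N: "N m < N (Suc m)" for m using h(1) by (simp add: N_def)
  hence Ns: "strict_mono N" by (simp add: strict_mono_Suc_iff)
  have inc: "incseq (\<lambda>m. \<Union>i\<le>N m. c (a i))"
  proof (rule incseq_SucI)
    fix m
    have "N m \<le> N (Suc m)" using N[of m] by simp
    thus "(\<Union>i\<le>N m. c (a i)) \<subseteq> (\<Union>i\<le>N (Suc m). c (a i))" by fastforce
  qed
  show ?thesis
  proof (rule that[of "\<lambda>m. \<Union>i\<le>N m. c (a i)" "\<lambda>m. \<Union>i\<le>N (Suc m). w (a i)", OF _ _ _ _ inc])
    show "(\<Union>m. \<Union>i\<le>N m. c (a i)) = S"
    proof
      show "S \<subseteq> (\<Union>m. \<Union>i\<le>N m. c (a i))"
      proof
        fix x assume x: "x \<in> S"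
        then obtain i where "x \<in> w (a i)" using cov by auto
        hence "x \<in> c (a i)" using wc[OF aS[of i]] x by auto
        moreover have "i \<le> N i" by (rule strict_mono_imp_increasing[OF Ns])
        ultimately show "x \<in> (\<Union>m. \<Union>i\<le>N m. c (a i))" by blast
      qed
    qed (use wc aS in blast)
    fix m
    show "(\<Union>i\<le>N m. c (a i)) \<subseteq> (\<Union>i\<le>N (Suc m). w (a i))" using h(2)[of "N m"] by (simp add: N_def)
    show "(\<Union>i\<le>N (Suc m). w (a i)) \<inter> S \<subseteq> (\<Union>i\<le>N (Suc m). c (a i))" using wc aS by blast
  qed (use wc aS in auto)
qed

text \<open>The sets where \<open>w n < e\<close> are relatively open and cover \<open>K\<close>;
  since the sequence decreases, the largest index of a finite subcover works everywhere on
  \<open>K\<close>.\<close>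

lemma dini_to_zero:
  fixes w :: "nat \<Rightarrow> 'a::topological_space \<Rightarrow> real"
  assumes K: "compact K" and c: "\<And>n. continuous_on K (w n)"
    and dec: "\<And>x. x \<in> K \<Longrightarrow> decseq (\<lambda>n. w n x)" and lim: "\<And>x. x \<in> K \<Longrightarrow> (\<lambda>n. w n x) \<longlonglongrightarrow> 0"
    and e: "0 < e"
  shows "\<exists>n0. \<forall>n\<ge>n0. \<forall>x\<in>K. w n x < e"
proof -
  have "\<exists>A. open A \<and> A \<inter> K = w n -` {..<e} \<inter> K" for n
    using c[of n] by (simp add: continuous_on_open_invariant)
  then obtain A where A: "\<And>n. open (A n)" "\<And>n. A n \<inter> K = w n -` {..<e} \<inter> K" by metis
  have "K \<subseteq> (\<Union>n\<in>UNIV. A n)"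
  proof
    fix x assume x: "x \<in> K"
    from order_tendstoD(2)[OF lim[OF x] e] obtain n where "w n x < e"
      by (auto simp: eventually_sequentially)
    thus "x \<in> (\<Union>n\<in>UNIV. A n)" using A(2)[of n] x by auto
  qed
  then obtain D where D: "finite D" "K \<subseteq> (\<Union>n\<in>D. A n)"
    using compactE_image[OF K, of UNIV A] A(1) by metis
  obtain m where m: "\<And>i. i \<in> D \<Longrightarrow> i \<le> m" using D(1) unfolding finite_nat_set_iff_bounded_le by auto
  have "w n x < e" if mn: "m \<le> n" and x: "x \<in> K" for n x
  proof -
    obtain i where i: "i \<in> D" "x \<in> A i" using D(2) x by auto
    hence "w i x < e" using A(2)[of i] x by auto
    moreover have "w n x \<le> w i x" using decseqD[OF dec[OF x], of i n] m[OF i(1)] mn by simp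
    ultimately show ?thesis by simp
  qed
  thus ?thesis by blast
qed

subsection \<open>Discounting a time\<close>

lemma LIMSEQ_zero_iff_INF_ennreal:
  fixes a :: "nat \<Rightarrow> real"
  assumes dec: "decseq a" and nonneg: "\<And>n. 0 \<le> a n"
  shows "(INF n. ennreal (a n)) = 0 \<longleftrightarrow> a \<longlonglongrightarrow> 0"
proof -
  have "decseq (\<lambda>n. ennreal (a n))" using dec by (auto simp: decseq_def intro: ennreal_leI)
  hence lim: "(\<lambda>n. ennreal (a n)) \<longlonglongrightarrow> (INF n. ennreal (a n))" by (rule LIMSEQ_INF)
  have "(\<lambda>n. ennreal (a n)) \<longlonglongrightarrow> ennreal 0 \<longleftrightarrow> a \<longlonglongrightarrow> 0"
    using nonneg by (intro tendsto_ennreal_iff) auto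
  thus ?thesis using lim LIMSEQ_unique by fastforce
qed

text \<open>Infinity has its own case because \<open>enn2real\<close> sends it to 0, which would
  give the value 1.\<close>

definition discount :: "real \<Rightarrow> ennreal \<Rightarrow> ennreal" where
  "discount \<alpha> t = (if t = \<infinity> then 0 else ennreal (exp (- \<alpha> * enn2real t)))"

lemma measurable_discount [measurable]: "discount \<alpha> \<in> borel_measurable borel"
  unfolding discount_def[abs_def] by measurable

lemma discount_antimono:
  assumes "0 < \<alpha>" "s \<le> t" shows "discount \<alpha> t \<le> discount \<alpha> s"
proof (cases "t = \<infinity>")
  case False
  hence "enn2real s \<le> enn2real t" using assms by (intro enn2real_mono) (auto simp: less_top)
  moreover have "s \<noteq> \<infinity>" using assms False by (auto simp: top_unique)
  ultimately show ?thesis using False assms by (auto simp: discount_def intro!: ennreal_leI)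
qed (simp add: discount_def)

text \<open>Turns divergence of the jump times into the vanishing of a bounded quantity with
  computable expectation. The discount of a finite supremum is a positive lower bound; an infinite
  supremum pushes the infimum below exp(-\<alpha> B) for each natural \<open>B\<close>.\<close>

lemma INF_discount_eq_0_iff:
  assumes a: "0 < \<alpha>"
  shows "(INF n::nat. discount \<alpha> (t n)) = 0 \<longleftrightarrow> (SUP n. t n) = \<infinity>"
proof
  assume 0: "(INF n. discount \<alpha> (t n)) = 0"
  show "(SUP n. t n) = \<infinity>"
  proof (rule ccontr)
    assume "(SUP n. t n) \<noteq> \<infinity>"
    hence "0 < discount \<alpha> (SUP n. t n)" by (simp add: discount_def)
    also have "\<dots> \<le> (INF n. discount \<alpha> (t n))"
      by (intro INF_greatest discount_antimono[OF a] SUP_upper) simp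
    finally show False using 0 by simp
  qed
next
  assume inf: "(SUP n. t n) = \<infinity>"
  have "(INF n. discount \<alpha> (t n)) \<le> ennreal (exp (- \<alpha> * of_nat B))" for B :: nat
  proof -
    have "ennreal (of_nat B) < (SUP n. t n)" unfolding inf by simp
    then obtain n where "ennreal (of_nat B) < t n" by (auto simp: less_SUP_iff)
    hence "discount \<alpha> (t n) \<le> discount \<alpha> (ennreal (of_nat B))" by (intro discount_antimono[OF a]) simp
    thus ?thesis by (intro INF_lower2[of n]) (simp_all add: discount_def)
  qed
  hence "(INF n. discount \<alpha> (t n)) \<le> (INF B. ennreal (exp (- \<alpha> * of_nat B)))" by (intro INF_greatest)
  also have "\<dots> = 0"
  proof (subst LIMSEQ_zero_iff_INF_ennreal)
    show "(\<lambda>B. exp (- \<alpha> * real B)) \<longlonglongrightarrow> 0"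
      using LIMSEQ_power_zero[of "exp (- \<alpha>)"] a exp_of_nat_mult[of _ "- \<alpha>"] by (simp add: mult.commute)
  qed (use a in \<open>auto simp: decseq_def\<close>)
  finally show "(INF n. discount \<alpha> (t n)) = 0" by simp
qed

lemma pure_jump_processD:
  assumes "pure_jump_process S q x M T Z X"
  shows "prob_space M" "T n \<in> borel_measurable M" "AE \<omega> in M. T 0 \<omega> = 0 \<and> Z 0 \<omega> = Some x"
  using assms unfolding pure_jump_process_def by blast+

subsection \<open>The resolvent of the jump chain\<close>

locale Q_space =
  fixes S :: "'a::polish_space set" and q :: "'a \<Rightarrow> 'a set \<Rightarrow> real"
  assumes S_borel: "S \<in> sets borel" and Q: "Q_function S q" and S_ne: "S \<noteq> {}"
begin

lemmas rate_nonneg = qrate_nonneg[OF S_borel Q S_ne]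
lemmas rate_measurable [measurable] = measurable_qrate[OF S_borel Q S_ne]
lemmas mass = emeasure_qtilde_S[OF S_borel Q S_ne]
lemmas space_q [simp] = space_qtilde[OF S_borel Q S_ne]
lemmas sets_q [simp, measurable_cong] = sets_qtilde[OF S_borel Q S_ne]
lemmas space_S [simp] = space_BS[OF S_borel Q S_ne]

definition unit_valued :: "('a \<Rightarrow> real) set" where
  "unit_valued = {g \<in> borel_measurable (borelS S). \<forall>x\<in>S. 0 \<le> g x \<and> g x \<le> 1}"

lemma unit_valuedD:
  assumes "g \<in> unit_valued"
  shows "g \<in> borel_measurable (borelS S)" "x \<in> S \<Longrightarrow> 0 \<le> g x" "x \<in> S \<Longrightarrow> g x \<le> 1"
  using assms by (auto simp: unit_valued_def)

lemma one_unit_valued: "(\<lambda>_. 1) \<in> unit_valued" by (simp add: unit_valued_def)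

lemma integrable_bounded:
  assumes x: "x \<in> S" and g: "g \<in> borel_measurable (borelS S)" "\<And>y. y \<in> S \<Longrightarrow> \<bar>g y\<bar> \<le> (B::real)"
  shows "integrable (qtilde S q x) g"
proof -
  interpret finite_measure "qtilde S q x" by (rule finite_qtilde[OF S_borel Q S_ne x])
  have "g \<in> borel_measurable (qtilde S q x)" using g(1) by measurable
  thus ?thesis by (rule integrable_const_bound[where B=B, rotated]) (use g(2) in auto)
qed

lemma integrable_unit_valued: "x \<in> S \<Longrightarrow> g \<in> unit_valued \<Longrightarrow> integrable (qtilde S q x) g"
  by (rule integrable_bounded[where B=1]) (auto simp: unit_valued_def)

lemma integral_const: "x \<in> S \<Longrightarrow> (\<integral>y. c \<partial>qtilde S q x) = c * qrate q x"
  using mass[of x] rate_nonneg[of x] by (simp add: measure_def)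

text \<open>The expectation of exp(-\<alpha> t) g(y) over the first jump from \<open>x\<close>, with
  waiting time t, post-jump state y, and g counted as 0 at the cemetery. A positive \<alpha> keeps
  the denominator nonzero at absorbing states.\<close>

definition resolvent :: "real \<Rightarrow> ('a \<Rightarrow> real) \<Rightarrow> 'a \<Rightarrow> real" where
  "resolvent \<alpha> g x = (\<integral>y. g y \<partial>qtilde S q x) / (\<alpha> + qrate q x)"

lemma rate_pos: "0 < \<alpha> \<Longrightarrow> x \<in> S \<Longrightarrow> 0 < \<alpha> + qrate q x"
  using rate_nonneg[of x] by simp

text \<open>Pure algebra, as both sides contain the same Bochner integral: move the diagonal term
  \<open>qrate q x * U x\<close> across and divide by the positive
  \<open>\<alpha> + qrate q x\<close>.\<close>

lemma le_qint_iff: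
  assumes "0 < \<alpha>" "x \<in> S"
  shows "\<alpha> * U x \<le> qint S q U x \<longleftrightarrow> U x \<le> resolvent \<alpha> U x"
    and "qint S q U x \<le> \<alpha> * U x \<longleftrightarrow> resolvent \<alpha> U x \<le> U x"
    and "\<alpha> * U x = qint S q U x \<longleftrightarrow> U x = resolvent \<alpha> U x"
  unfolding qint_def resolvent_def pos_le_divide_eq[OF rate_pos[OF assms]]
    pos_divide_le_eq[OF rate_pos[OF assms]] nonzero_eq_divide_eq[OF rate_pos[OF assms, THEN less_imp_neq, symmetric]]
  by (auto simp: algebra_simps)

lemma resolvent_mono:
  assumes a: "0 < \<alpha>" and x: "x \<in> S" and int: "integrable (qtilde S q x) f" "integrable (qtilde S q x) g"
    and le: "\<And>y. y \<in> S \<Longrightarrow> f y \<le> g y"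
  shows "resolvent \<alpha> f x \<le> resolvent \<alpha> g x"
proof -
  have "(\<integral>y. f y \<partial>qtilde S q x) \<le> (\<integral>y. g y \<partial>qtilde S q x)"
    using le by (intro integral_mono[OF int]) simp
  thus ?thesis
    unfolding resolvent_def using rate_pos[OF a x] by (intro divide_right_mono) simp_all
qed

text \<open>The factor \<open>qrate q x / (\<alpha> + qrate q x)\<close> stays away from 1 wherever
  the rates are bounded; this is the contraction behind (a).\<close>

lemma resolvent_le:
  assumes a: "0 < \<alpha>" and x: "x \<in> S" and int: "integrable (qtilde S q x) f"
    and le: "\<And>y. y \<in> S \<Longrightarrow> f y \<le> c"
  shows "resolvent \<alpha> f x \<le> c * (qrate q x / (\<alpha> + qrate q x))"
proof -
  have "integrable (qtilde S q x) (\<lambda>_. c)" by (rule integrable_bounded[OF x, of _ "\<bar>c\<bar>"]) auto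
  from resolvent_mono[OF a x int this le] show ?thesis
    by (simp only: resolvent_def integral_const[OF x] times_divide_eq_right)
qed

lemma measurable_integral_qtilde:
  fixes g :: "'a \<Rightarrow> real"
  assumes g [measurable]: "g \<in> borel_measurable (borelS S)" and nn: "\<And>y. y \<in> S \<Longrightarrow> 0 \<le> g y"
  shows "(\<lambda>x. \<integral>y. g y \<partial>qtilde S q x) \<in> borel_measurable (borelS S)"
proof -
  have "(\<lambda>x. \<integral>\<^sup>+y. ennreal (g y) \<partial>qtilde S q x) \<in> borel_measurable (borelS S)"
    by (rule nn_integral_qtilde_measurable[OF S_borel Q S_ne, where h="\<lambda>x. x"]) measurable
  hence "(\<lambda>x. enn2real (\<integral>\<^sup>+y. ennreal (g y) \<partial>qtilde S q x)) \<in> borel_measurable (borelS S)"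
    by (rule measurable_compose) measurable
  moreover have "(\<integral>y. g y \<partial>qtilde S q x) = enn2real (\<integral>\<^sup>+y. ennreal (g y) \<partial>qtilde S q x)" for x
  proof (rule integral_eq_nn_integral)
    show "g \<in> borel_measurable (qtilde S q x)" using g by measurable
    show "AE y in qtilde S q x. 0 \<le> g y" using nn by (intro AE_I2) simp
  qed
  ultimately show ?thesis by (simp only:)
qed

lemma resolvent_unit_valued:
  assumes a: "0 < \<alpha>" and g: "g \<in> unit_valued"
  shows "resolvent \<alpha> g \<in> unit_valued"
proof -
  note [measurable] = measurable_integral_qtilde[OF unit_valuedD(1,2)[OF g]]
  have "resolvent \<alpha> g \<in> borel_measurable (borelS S)"
    unfolding resolvent_def[abs_def] by measurable
  moreover have "0 \<le> resolvent \<alpha> g x" if x: "x \<in> S" for x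
    unfolding resolvent_def
    using rate_pos[OF a x] unit_valuedD(2)[OF g] by (intro divide_nonneg_pos integral_nonneg_AE) auto
  moreover have "resolvent \<alpha> g x \<le> 1" if x: "x \<in> S" for x
    using resolvent_le[OF a x integrable_unit_valued[OF x g], of 1] unit_valuedD(3)[OF g] a rate_pos[OF a x]
    by (smt (verit) divide_le_eq_1 mult_1)
  ultimately show ?thesis by (simp add: unit_valued_def)
qed

lemma resolvent_tendsto:
  assumes a: "0 < \<alpha>" and x: "x \<in> S" and g: "\<And>n. g n \<in> unit_valued"
    and h: "h \<in> borel_measurable (borelS S)" and lim: "\<And>y. y \<in> S \<Longrightarrow> (\<lambda>n. g n y) \<longlonglongrightarrow> h y"
  shows "(\<lambda>n. resolvent \<alpha> (g n) x) \<longlonglongrightarrow> resolvent \<alpha> h x"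
proof -
  have "(\<lambda>n. \<integral>y. g n y \<partial>qtilde S q x) \<longlonglongrightarrow> (\<integral>y. h y \<partial>qtilde S q x)"
  proof (rule integral_dominated_convergence[where w="\<lambda>_. 1"])
    show "h \<in> borel_measurable (qtilde S q x)" using h by measurable
    show "g n \<in> borel_measurable (qtilde S q x)" for n using unit_valuedD(1)[OF g] by measurable
    show "integrable (qtilde S q x) (\<lambda>_. 1 :: real)" by (rule integrable_bounded[OF x, of _ 1]) auto
    show "AE y in qtilde S q x. (\<lambda>n. g n y) \<longlonglongrightarrow> h y" using lim by (intro AE_I2) simp
    show "AE y in qtilde S q x. norm (g n y) \<le> 1" for n
      using unit_valuedD(2,3)[OF g] by (intro AE_I2) simp
  qed
  thus ?thesis unfolding resolvent_def using rate_pos[OF a x] by (intro tendsto_divide) auto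
qed

lemma resolvent_funpow_unit_valued: "0 < \<alpha> \<Longrightarrow> g \<in> unit_valued \<Longrightarrow> (resolvent \<alpha> ^^ n) g \<in> unit_valued"
  by (induction n) (auto intro: resolvent_unit_valued)

section \<open>Iterates of the resolvent and their limit\<close>

text \<open>The values of \<open>E\<^sub>x exp(-\<alpha> t\<^sub>n)\<close> and \<open>E\<^sub>x exp(-\<alpha> t\<^sub>\<infinity>)\<close>.\<close>

definition survival_mass :: "real \<Rightarrow> nat \<Rightarrow> 'a \<Rightarrow> real" where
  "survival_mass \<alpha> n = (resolvent \<alpha> ^^ n) (\<lambda>_. 1)"

lemma survival_mass_unit_valued: "0 < \<alpha> \<Longrightarrow> survival_mass \<alpha> n \<in> unit_valued"
  unfolding survival_mass_def by (intro resolvent_funpow_unit_valued one_unit_valued)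

lemma survival_mass_Suc: "survival_mass \<alpha> (Suc n) = resolvent \<alpha> (survival_mass \<alpha> n)"
  by (simp add: survival_mass_def)

text \<open>The first iterate lies below 1, and monotonicity of the resolvent propagates this
  inequality.\<close>

lemma survival_mass_decseq:
  assumes a: "0 < \<alpha>" and x: "x \<in> S" shows "decseq (\<lambda>n. survival_mass \<alpha> n x)"
proof -
  have "survival_mass \<alpha> (Suc n) x \<le> survival_mass \<alpha> n x" if "x \<in> S" for n x
    using that
  proof (induction n arbitrary: x)
    case 0
    thus ?case using unit_valuedD(3)[OF survival_mass_unit_valued[OF a, of "Suc 0"]]
      by (simp add: survival_mass_def[of _ 0])
  next
    case (Suc n)
    have "resolvent \<alpha> (survival_mass \<alpha> (Suc n)) x \<le> resolvent \<alpha> (survival_mass \<alpha> n) x"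
      by (intro resolvent_mono[OF a Suc.prems] integrable_unit_valued survival_mass_unit_valued a Suc)
    thus ?case by (simp only: survival_mass_Suc)
  qed
  thus ?thesis using x by (intro decseq_SucI) auto
qed

definition explosion_mass :: "real \<Rightarrow> 'a \<Rightarrow> real" where
  "explosion_mass \<alpha> x = lim (\<lambda>n. survival_mass \<alpha> n x)"

lemma survival_mass_tendsto:
  assumes a: "0 < \<alpha>" and x: "x \<in> S"
  shows "(\<lambda>n. survival_mass \<alpha> n x) \<longlonglongrightarrow> explosion_mass \<alpha> x"
proof -
  have "Bseq (\<lambda>n. survival_mass \<alpha> n x)"
    using unit_valuedD(2,3)[OF survival_mass_unit_valued[OF a] x] by (intro BseqI'[of _ 1]) auto
  hence "convergent (\<lambda>n. survival_mass \<alpha> n x)"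
    using decseq_imp_monoseq[OF survival_mass_decseq[OF a x]] by (rule Bseq_monoseq_convergent)
  thus ?thesis by (simp add: convergent_LIMSEQ_iff explosion_mass_def)
qed

lemma explosion_mass_unit_valued:
  assumes a: "0 < \<alpha>" shows "explosion_mass \<alpha> \<in> unit_valued"
proof -
  have "explosion_mass \<alpha> \<in> borel_measurable (borelS S)"
    by (rule borel_measurable_LIMSEQ_metric[where f="\<lambda>n. survival_mass \<alpha> n", OF unit_valuedD(1)[OF survival_mass_unit_valued[OF a]]])
       (use survival_mass_tendsto[OF a] in auto)
  moreover have "0 \<le> explosion_mass \<alpha> x \<and> explosion_mass \<alpha> x \<le> 1" if x: "x \<in> S" for x
    using unit_valuedD(2,3)[OF survival_mass_unit_valued[OF a] x]
    by (intro conjI LIMSEQ_le_const[OF survival_mass_tendsto[OF a x]] LIMSEQ_le_const2[OF survival_mass_tendsto[OF a x]]) auto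
  ultimately show ?thesis by (simp add: unit_valued_def)
qed

text \<open>Dominated convergence passes the limit through the recursion
  \<open>survival_mass_Suc\<close>.\<close>

lemma explosion_mass_fixpoint:
  assumes a: "0 < \<alpha>" and x: "x \<in> S"
  shows "explosion_mass \<alpha> x = resolvent \<alpha> (explosion_mass \<alpha>) x"
proof (rule LIMSEQ_unique)
  show "(\<lambda>n. survival_mass \<alpha> (Suc n) x) \<longlonglongrightarrow> explosion_mass \<alpha> x"
    using survival_mass_tendsto[OF a x] by (rule LIMSEQ_Suc)
  show "(\<lambda>n. survival_mass \<alpha> (Suc n) x) \<longlonglongrightarrow> resolvent \<alpha> (explosion_mass \<alpha>) x"
    unfolding survival_mass_Suc
    by (rule resolvent_tendsto[OF a x survival_mass_unit_valued[OF a] unit_valuedD(1)[OF explosion_mass_unit_valued[OF a]]])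
       (rule survival_mass_tendsto[OF a])
qed

text \<open>Starting from \<open>U \<le> 1\<close>, monotonicity keeps \<open>U\<close> below every
  iterate and so below the limit. Hence a nontrivial subsolution forces a nonzero
  \<open>explosion_mass\<close>.\<close>

lemma subsolution_le_explosion_mass:
  assumes a: "0 < \<alpha>" and U: "U \<in> unit_valued" and sub: "\<And>x. x \<in> S \<Longrightarrow> U x \<le> resolvent \<alpha> U x"
    and x: "x \<in> S"
  shows "U x \<le> explosion_mass \<alpha> x"
proof -
  have "U x \<le> survival_mass \<alpha> n x" if "x \<in> S" for n x
    using that
  proof (induction n arbitrary: x)
    case 0 thus ?case using unit_valuedD(3)[OF U] by (simp add: survival_mass_def)
  next
    case (Suc n)
    have "resolvent \<alpha> U x \<le> resolvent \<alpha> (survival_mass \<alpha> n) x"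
      by (rule resolvent_mono[OF a Suc.prems])
         (use Suc U survival_mass_unit_valued[OF a] in \<open>auto intro: integrable_unit_valued\<close>)
    thus ?case using sub[OF Suc.prems] by (simp add: survival_mass_Suc)
  qed
  thus ?thesis using x by (intro LIMSEQ_le_const[OF survival_mass_tendsto[OF a x]]) auto
qed

subsection \<open>Discounted jump times\<close>

(* In Defs even the definitions are exported with the assumptions of their context. *)
lemmas pair_lift_unfold = pair_lift_def[OF S_borel Q S_ne]
lemmas density_op_unfold = density_op_def[OF S_borel Q S_ne]
lemmas jump_op_unfold = jump_op_def[OF S_borel Q S_ne]

text \<open>Test functions whose form is preserved by one jump, which only replaces \<open>g\<close>
  by \<open>resolvent \<alpha> g\<close>.\<close>

definition discounted :: "real \<Rightarrow> ('a \<Rightarrow> real) \<Rightarrow> ennreal \<times> 'a option \<Rightarrow> ennreal" where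
  "discounted \<alpha> g = pair_lift (\<lambda>s x. ennreal (exp (- \<alpha> * s) * g x)) 0"

lemma discounted_measurable:
  assumes g [measurable]: "g \<in> borel_measurable (borelS S)"
  shows "discounted \<alpha> g \<in> borel_measurable (jump_pair_space S)"
  unfolding discounted_def by (rule measurable_pair_lift[OF S_borel Q S_ne]) measurable

text \<open>The discount and the survival probability merge into one exponential of rate
  \<open>\<alpha> + qrate q x\<close>.\<close>

lemma density_op_discounted:
  assumes a: "0 < \<alpha>" and x: "x \<in> S" and s: "0 \<le> s" and g: "g \<in> unit_valued"
  shows "density_op S q (discounted \<alpha> g) s x = ennreal (exp (- \<alpha> * s) * resolvent \<alpha> g x)"
proof -
  define r where "r = \<alpha> + qrate q x"
  define I where "I = (\<integral>y. g y \<partial>qtilde S q x)"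
  have r: "0 < r" unfolding r_def by (rule rate_pos[OF a x])
  have I: "0 \<le> I" unfolding I_def using unit_valuedD(2)[OF g] by (intro integral_nonneg_AE AE_I2) simp
  have "(\<integral>\<^sup>+y. ennreal (g y) \<partial>qtilde S q x) = ennreal I"
    unfolding I_def
    using unit_valuedD(2)[OF g] by (intro nn_integral_eq_integral integrable_unit_valued[OF x g] AE_I2) simp
  \<comment> \<open>\<open>ennreal\<close> truncates negative reals, hence \<open>0 \<le> t\<close>;
    the integration runs over \<open>t > s \<ge> 0\<close>.\<close>
  hence inner: "(\<integral>\<^sup>+y. discounted \<alpha> g (ennreal t, Some y) \<partial>qtilde S q x) = ennreal (exp (- \<alpha> * t)) * ennreal I"
    if "0 \<le> t" for t
    using that unit_valuedD(1)[OF g]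
    by (simp add: discounted_def pair_lift_unfold ennreal_mult' nn_integral_cmult)
  \<comment> \<open>Dividing and multiplying by \<open>r\<close> exposes the exponential density of
    rate \<open>r\<close> on \<open>{s<..}\<close>, of total mass 1.\<close>
  have "density_op S q (discounted \<alpha> g) s x =
      (\<integral>\<^sup>+t. ennreal (exp (- \<alpha> * s) * (I / r)) * (ennreal (exp (- r * (t - s))) * ennreal r * indicator {s<..} t) \<partial>lborel)"
    unfolding density_op_unfold
  proof (rule nn_integral_cong)
    fix t
    have "exp (- qrate q x * (t - s)) * (exp (- \<alpha> * t) * I) =
        exp (- \<alpha> * s) * (I / r) * (exp (- r * (t - s)) * r)"
    proof -
      have "exp (- qrate q x * (t - s)) * exp (- \<alpha> * t) = exp (- \<alpha> * s) * exp (- r * (t - s))"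
        unfolding exp_add[symmetric] r_def by (simp add: algebra_simps)
      moreover have "I = I / r * r" using r by simp
      ultimately show ?thesis by (metis mult.assoc mult.commute)
    qed
    hence "ennreal (exp (- qrate q x * (t - s))) * (ennreal (exp (- \<alpha> * t)) * ennreal I) =
        ennreal (exp (- \<alpha> * s) * (I / r)) * (ennreal (exp (- r * (t - s))) * ennreal r)"
      using r I by (simp add: ennreal_mult''[symmetric] del: minus_mult_left[symmetric] mult_minus_left)
    thus "ennreal (exp (- qrate q x * (t - s))) *
         (\<integral>\<^sup>+y. discounted \<alpha> g (ennreal t, Some y) \<partial>qtilde S q x) * indicator {s<..} t =
        ennreal (exp (- \<alpha> * s) * (I / r)) * (ennreal (exp (- r * (t - s))) * ennreal r * indicator {s<..} t)"
      using inner[of t] s by (cases "s < t") (simp_all add: mult.assoc)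
  qed
  also have "\<dots> = ennreal (exp (- \<alpha> * s) * (I / r)) *
      (\<integral>\<^sup>+t\<in>{s<..}. ennreal (exp (- r * (t - s))) * ennreal r \<partial>lborel)"
    by (rule nn_integral_cmult) measurable
  also have "(\<integral>\<^sup>+t\<in>{s<..}. ennreal (exp (- r * (t - s))) * ennreal r \<partial>lborel) = 1"
    using exp_tail[OF S_borel Q S_ne, of r s s] r by simp
  finally show ?thesis by (simp add: resolvent_def I_def r_def)
qed

text \<open>The mass left over by the jump density sits at \<open>(\<infinity>, None)\<close>, where
  \<open>discounted\<close> is 0.\<close>

lemma jump_op_discounted:
  assumes a: "0 < \<alpha>" and g: "g \<in> unit_valued" and p: "p \<in> space (jump_pair_space S)"
  shows "jump_op S q (discounted \<alpha> g) p = discounted \<alpha> (resolvent \<alpha> g) p"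
proof -
  have 0: "discounted \<alpha> g (\<infinity>, None) = 0" by (simp add: discounted_def pair_lift_unfold)
  obtain s z where pz: "p = (s, z)" "z = None \<or> (\<exists>x\<in>S. z = Some x)"
    using p by (cases p) (auto simp: space_JP[OF S_borel Q S_ne])
  have dens: "density_op S q (discounted \<alpha> g) (enn2real s) x =
      ennreal (exp (- \<alpha> * enn2real s) * resolvent \<alpha> g x)" if "x \<in> S" for x
    by (rule density_op_discounted[OF a that _ g]) simp
  have "jump_op S q (discounted \<alpha> g) p = pair_lift (density_op S q (discounted \<alpha> g)) 0 p"
    unfolding jump_op_unfold 0 by simp
  also have "\<dots> = discounted \<alpha> (resolvent \<alpha> g) p"
    using pz(2)
  proof
    assume "\<exists>x\<in>S. z = Some x"
    then obtain x where "x \<in> S" "z = Some x" by blast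
    thus ?thesis using dens[of x] by (simp add: pz(1) discounted_def pair_lift_unfold)
  qed (simp add: pz(1) discounted_def pair_lift_unfold)
  finally show ?thesis .
qed

text \<open>Integrating out the last jump replaces \<open>g\<close> by
  \<open>resolvent \<alpha> g\<close> at the preceding index, so the induction keeps
  \<open>g\<close> arbitrary.\<close>

lemma nn_integral_discounted:
  assumes P: "pure_jump_process S q x M T Z X" and x: "x \<in> S" and a: "0 < \<alpha>" and g: "g \<in> unit_valued"
  shows "(\<integral>\<^sup>+\<omega>. discounted \<alpha> g (T n \<omega>, Z n \<omega>) \<partial>M) = ennreal ((resolvent \<alpha> ^^ n) g x)"
  using g
proof (induction n arbitrary: g)
  case 0
  interpret prob_space M by (rule pure_jump_processD(1)[OF P])
  have "AE \<omega> in M. T 0 \<omega> = 0 \<and> Z 0 \<omega> = Some x" by (rule pure_jump_processD(3)[OF P])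
  hence "AE \<omega> in M. discounted \<alpha> g (T 0 \<omega>, Z 0 \<omega>) = ennreal (g x)"
    by eventually_elim (simp add: discounted_def pair_lift_unfold)
  hence "(\<integral>\<^sup>+\<omega>. discounted \<alpha> g (T 0 \<omega>, Z 0 \<omega>) \<partial>M) = (\<integral>\<^sup>+\<omega>. ennreal (g x) \<partial>M)"
    by (rule nn_integral_cong_AE)
  thus ?case by (simp add: emeasure_space_1)
next
  case (Suc n)
  have "(\<integral>\<^sup>+\<omega>. discounted \<alpha> g (T (Suc n) \<omega>, Z (Suc n) \<omega>) \<partial>M) =
      (\<integral>\<^sup>+\<omega>. jump_op S q (discounted \<alpha> g) (T n \<omega>, Z n \<omega>) \<partial>M)"
    using jump_step[OF S_borel Q S_ne P x borel_measurable_const[of 1]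
        discounted_measurable[OF unit_valuedD(1)[OF Suc.prems]], where n=n] by simp
  also have "\<dots> = (\<integral>\<^sup>+\<omega>. discounted \<alpha> (resolvent \<alpha> g) (T n \<omega>, Z n \<omega>) \<partial>M)"
    by (intro nn_integral_cong jump_op_discounted[OF a Suc.prems]
        measurable_space[OF N_meas[OF S_borel Q S_ne P x]])
  also have "\<dots> = ennreal ((resolvent \<alpha> ^^ n) (resolvent \<alpha> g) x)"
    by (rule Suc.IH[OF resolvent_unit_valued[OF a Suc.prems]])
  finally show ?case by (simp only: funpow_Suc_right o_apply)
qed

text \<open>\<open>discount \<alpha>\<close> and \<open>discounted \<alpha> (\<lambda>_. 1)\<close>
  differ only at a finite time paired with the cemetery. The jump kernel gives such pairs no mass,
  so both have the same image under \<open>jump_op\<close>; index 0 is settled by the initial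
  law.\<close>

lemma nn_integral_discount_jump_time:
  assumes P: "pure_jump_process S q x M T Z X" and x: "x \<in> S" and a: "0 < \<alpha>"
  shows "(\<integral>\<^sup>+\<omega>. discount \<alpha> (T n \<omega>) \<partial>M) = ennreal (survival_mass \<alpha> n x)"
proof (cases n)
  case 0
  interpret prob_space M by (rule pure_jump_processD(1)[OF P])
  have "AE \<omega> in M. T 0 \<omega> = 0 \<and> Z 0 \<omega> = Some x" by (rule pure_jump_processD(3)[OF P])
  hence "AE \<omega> in M. discount \<alpha> (T 0 \<omega>) = 1"
    by eventually_elim (simp add: discount_def)
  hence "(\<integral>\<^sup>+\<omega>. discount \<alpha> (T 0 \<omega>) \<partial>M) = (\<integral>\<^sup>+\<omega>. 1 \<partial>M)"
    by (rule nn_integral_cong_AE)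
  thus ?thesis using 0 by (simp add: emeasure_space_1 survival_mass_def)
next
  case (Suc m)
  have m: "(\<lambda>p. discount \<alpha> (fst p)) \<in> borel_measurable (jump_pair_space S)"
    unfolding jump_pair_space_def by measurable
  have "discount \<alpha> t = discounted \<alpha> (\<lambda>_. 1) (t, Some y)" for t and y :: 'a
    by (simp add: discount_def discounted_def pair_lift_unfold)
  hence jump: "jump_op S q (\<lambda>p. discount \<alpha> (fst p)) = jump_op S q (discounted \<alpha> (\<lambda>_. 1))"
    unfolding jump_op_unfold density_op_unfold by (simp add: discount_def discounted_def pair_lift_unfold)
  have "(\<integral>\<^sup>+\<omega>. discount \<alpha> (T n \<omega>) \<partial>M) = (\<integral>\<^sup>+\<omega>. jump_op S q (discounted \<alpha> (\<lambda>_. 1)) (T m \<omega>, Z m \<omega>) \<partial>M)"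
    using jump_step[OF S_borel Q S_ne P x borel_measurable_const[of 1] m, where n=m] Suc by (simp add: jump)
  also have "\<dots> = (\<integral>\<^sup>+\<omega>. discounted \<alpha> (\<lambda>_. 1) (T n \<omega>, Z n \<omega>) \<partial>M)"
    using jump_step[OF S_borel Q S_ne P x borel_measurable_const[of 1]
        discounted_measurable[OF unit_valuedD(1)[OF one_unit_valued]], where n=m] Suc by simp
  also have "\<dots> = ennreal (survival_mass \<alpha> n x)"
    unfolding survival_mass_def by (rule nn_integral_discounted[OF P x a one_unit_valued])
  finally show ?thesis .
qed

text \<open>The infimum of the discounted jump times is nonnegative, so it vanishes almost surely
  iff its integral, the limit of \<open>survival_mass\<close>, is 0. The left side does not involve
  \<alpha>, so any single \<alpha> decides nonexplosion.\<close>

lemma almost_surely_nonexplosive_iff: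
  assumes P: "pure_jump_process S q x M T Z X" and x: "x \<in> S" and a: "0 < \<alpha>"
  shows "measure M {\<omega> \<in> space M. lim (\<lambda>n. T n \<omega>) = \<infinity>} = 1 \<longleftrightarrow> explosion_mass \<alpha> x = 0"
proof -
  interpret prob_space M by (rule pure_jump_processD(1)[OF P])
  note [measurable] = pure_jump_processD(2)[OF P]
  have mono: "AE \<omega> in M. \<forall>n. T n \<omega> \<le> T (Suc n) \<omega>"
    using AE_T_mono[OF S_borel Q S_ne P x] by (simp add: AE_all_countable)
  have lim: "AE \<omega> in M. lim (\<lambda>n. T n \<omega>) = (SUP n. T n \<omega>)"
    using mono by eventually_elim (intro limI LIMSEQ_SUP incseq_SucI; blast)
  have "measure M {\<omega> \<in> space M. lim (\<lambda>n. T n \<omega>) = \<infinity>} = 1 \<longleftrightarrow> (AE \<omega> in M. lim (\<lambda>n. T n \<omega>) = \<infinity>)"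
    by (rule prob_Collect_eq_1) measurable
  also have "\<dots> \<longleftrightarrow> (AE \<omega> in M. (SUP n. T n \<omega>) = \<infinity>)"
  proof
    show "AE \<omega> in M. (SUP n. T n \<omega>) = \<infinity>" if "AE \<omega> in M. lim (\<lambda>n. T n \<omega>) = \<infinity>"
      using that lim by eventually_elim simp
    show "AE \<omega> in M. lim (\<lambda>n. T n \<omega>) = \<infinity>" if "AE \<omega> in M. (SUP n. T n \<omega>) = \<infinity>"
      using that lim by eventually_elim simp
  qed
  also have "\<dots> \<longleftrightarrow> (AE \<omega> in M. (INF n. discount \<alpha> (T n \<omega>)) = 0)"
    by (simp only: INF_discount_eq_0_iff[OF a])
  also have "\<dots> \<longleftrightarrow> (\<integral>\<^sup>+\<omega>. (INF n. discount \<alpha> (T n \<omega>)) \<partial>M) = 0"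
    by (rule nn_integral_0_iff_AE[symmetric]) measurable
  \<comment> \<open>Monotone convergence from above, justified by the finite integral at index
    0.\<close>
  also have "(\<integral>\<^sup>+\<omega>. (INF n. discount \<alpha> (T n \<omega>)) \<partial>M) = (INF n. \<integral>\<^sup>+\<omega>. discount \<alpha> (T n \<omega>) \<partial>M)"
  proof (rule nn_integral_monotone_convergence_INF_AE)
    show "AE \<omega> in M. discount \<alpha> (T (Suc i) \<omega>) \<le> discount \<alpha> (T i \<omega>)" for i
      using mono by eventually_elim (simp add: discount_antimono[OF a])
    show "(\<integral>\<^sup>+\<omega>. discount \<alpha> (T 0 \<omega>) \<partial>M) < \<infinity>"
      by (simp add: nn_integral_discount_jump_time[OF P x a])
  qed measurable
  also have "\<dots> = (INF n. ennreal (survival_mass \<alpha> n x))"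
    by (simp only: nn_integral_discount_jump_time[OF P x a])
  also have "\<dots> = 0 \<longleftrightarrow> (\<lambda>n. survival_mass \<alpha> n x) \<longlonglongrightarrow> 0"
    by (rule LIMSEQ_zero_iff_INF_ennreal[OF survival_mass_decseq[OF a x]
          unit_valuedD(2)[OF survival_mass_unit_valued[OF a] x]])
  also have "\<dots> \<longleftrightarrow> explosion_mass \<alpha> x = 0"
    using survival_mass_tendsto[OF a x] LIMSEQ_unique by metis
  finally show ?thesis .
qed

subsection \<open>Drift conditions\<close>

lemma explosion_mass_eq_0_of_drift:
  assumes drift: "drift_condition S q Sn V"
  obtains \<alpha> where "0 < \<alpha>" "\<And>x. x \<in> S \<Longrightarrow> explosion_mass \<alpha> x = 0"
proof -
  obtain \<alpha> where a: "0 < \<alpha>" and int: "\<And>x. x \<in> S \<Longrightarrow> integrable (qtilde S q x) V"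
    and le: "\<And>x. x \<in> S \<Longrightarrow> qint S q V x \<le> \<alpha> * V x"
  proof -
    have "\<exists>\<alpha>>0. \<forall>x\<in>S. integrable (qtilde S q x) V \<and> qint S q V x \<le> \<alpha> * V x"
      using drift unfolding drift_condition_def by (elim conjE)
    thus ?thesis using that by blast
  qed
  have V0: "0 \<le> V x" if "x \<in> S" for x
    using drift that by (simp add: drift_condition_def)
  have bdd: "bdd_above (qrate q ` Sn n)" for n
    using drift by (simp add: drift_condition_def)
  have lim: "(\<lambda>n. INF x\<in>S - Sn n. ereal (V x)) \<longlonglongrightarrow> \<infinity>"
    using drift by (simp add: drift_condition_def)
  define u where "u = explosion_mass \<alpha>"
  have u: "u \<in> unit_valued" unfolding u_def by (rule explosion_mass_unit_valued[OF a])
  have small: "u x \<le> e * V x" if e: "0 < e" and x: "x \<in> S" for e x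
  proof -
    \<comment> \<open>Where \<open>V\<close> exceeds \<open>1 / e\<close>, \<open>e * V\<close>
      exceeds 1 and hence dominates \<open>u\<close>.\<close>
    have "eventually (\<lambda>n. ereal (1 / e) < (INF x\<in>S - Sn n. ereal (V x))) sequentially"
      using order_tendstoD(1)[OF lim, of "ereal (1 / e)"] by simp
    then obtain n where n: "ereal (1 / e) < (INF x\<in>S - Sn n. ereal (V x))"
      by (auto simp: eventually_sequentially)
    have out: "u y \<le> e * V y" if "y \<in> S" "y \<notin> Sn n" for y
    proof -
      have "ereal (1 / e) < ereal (V y)"
        using less_le_trans[OF n INF_lower[of y "S - Sn n"]] that by blast
      hence "1 \<le> e * V y" using e by (simp add: field_simps)
      thus ?thesis using unit_valuedD(3)[OF u that(1)] by simp
    qed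
    obtain c where c: "\<And>y. y \<in> Sn n \<Longrightarrow> qrate q y \<le> c" "0 \<le> c"
    proof -
      obtain c where "\<And>y. y \<in> Sn n \<Longrightarrow> qrate q y \<le> c"
        using bdd[of n] by (auto simp: bdd_above_def)
      \<comment> \<open>The maximum covers an empty \<open>Sn n\<close>, for which the bound could
        be negative.\<close>
      thus ?thesis using that[of "max c 0"] by (simp add: le_max_iff_disj)
    qed
    \<comment> \<open>Bounds \<open>qrate q y / (\<alpha> + qrate q y)\<close> on
      \<open>Sn n\<close>, since this fraction increases with the rate.\<close>
    define \<theta> where "\<theta> = c / (\<alpha> + c)"
    have \<theta>: "0 \<le> \<theta>" "\<theta> < 1" using a c(2) by (auto simp: \<theta>_def)
    \<comment> \<open>The resolvent integrates over all of \<open>S\<close>, so the bound is carried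
      on all of \<open>S\<close>: on \<open>Sn n\<close> each step gains a factor \<theta>, and
      elsewhere the left side is nonpositive.\<close>
    have "u y - e * V y \<le> \<theta> ^ k" if "y \<in> S" for k y
      using that
    proof (induction k arbitrary: y)
      case 0
      have "0 \<le> e * V y" using e V0[OF 0] by simp
      thus ?case using unit_valuedD(3)[OF u 0] by simp
    next
      case (Suc k)
      show ?case
      proof (cases "y \<in> Sn n")
        case True
        note r = rate_nonneg[OF Suc.prems] rate_pos[OF a Suc.prems]
        have iu: "integrable (qtilde S q y) u" by (rule integrable_unit_valued[OF Suc.prems u])
        have iV: "integrable (qtilde S q y) (\<lambda>z. e * V z)" using int[OF Suc.prems] by simp
        have "resolvent \<alpha> V y \<le> V y" using le[OF Suc.prems] le_qint_iff(2)[OF a Suc.prems] by simp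
        hence "u y - e * V y \<le> resolvent \<alpha> u y - e * resolvent \<alpha> V y"
          using e explosion_mass_fixpoint[OF a Suc.prems] by (simp add: u_def)
        also have "\<dots> = resolvent \<alpha> (\<lambda>z. u z - e * V z) y"
          unfolding resolvent_def Bochner_Integration.integral_diff[OF iu iV] by (simp add: diff_divide_distrib)
        also have "\<dots> \<le> \<theta> ^ k * (qrate q y / (\<alpha> + qrate q y))"
          by (rule resolvent_le[OF a Suc.prems Bochner_Integration.integrable_diff[OF iu iV] Suc.IH])
        also have "\<dots> \<le> \<theta> ^ k * \<theta>"
        proof (rule mult_left_mono)
          have "qrate q y * \<alpha> \<le> c * \<alpha>" using c(1)[OF True] a by (intro mult_right_mono) auto
          thus "qrate q y / (\<alpha> + qrate q y) \<le> \<theta>"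
            unfolding \<theta>_def using r c(2) a by (simp add: divide_le_eq le_divide_eq algebra_simps)
        qed (use \<theta> in simp)
        finally show ?thesis by (simp add: mult.commute)
      next
        case False
        hence "u y - e * V y \<le> 0" using out[OF Suc.prems] by simp
        also have "0 \<le> \<theta> ^ Suc k" using \<theta>(1) by simp
        finally show ?thesis .
      qed
    qed
    hence "u x - e * V x \<le> \<theta> ^ k" for k using x by blast
    moreover have "(\<lambda>k. \<theta> ^ k) \<longlonglongrightarrow> 0" using \<theta> by (intro LIMSEQ_power_zero) simp
    ultimately have "u x - e * V x \<le> 0" by (intro LIMSEQ_le_const) auto
    thus ?thesis by simp
  qed
  have "u x = 0" if x: "x \<in> S" for x
  proof (rule antisym)
    show "u x \<le> 0"
    proof (rule field_le_epsilon)
      fix d :: real assume "0 < d"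
      \<comment> \<open>Adding 1 allows for \<open>V x = 0\<close>.\<close>
      hence "u x \<le> d / (V x + 1) * V x" using V0[OF x] by (intro small x) simp
      also have "\<dots> \<le> d" using V0[OF x] \<open>0 < d\<close> by (simp add: divide_le_eq)
      finally show "u x \<le> 0 + d" by simp
    qed
  qed (rule unit_valuedD(2)[OF u x])
  thus ?thesis using that a by (simp add: u_def)
qed

section \<open>Construction of a drift function from nonexplosion\<close>

text \<open>The continuity hypothesis concerns \<open>qint\<close>; adding back the continuous term
  \<open>qrate q x * g x\<close> recovers the integral against \<open>qtilde\<close>.\<close>

lemma continuous_resolvent:
  assumes a: "0 < \<alpha>" and rate: "continuous_on S (qrate q)"
    and feller: "\<And>f :: 'a \<Rightarrow> real. continuous_on S f \<Longrightarrow> bounded (f ` S) \<Longrightarrow> continuous_on S (qint S q f)"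
    and g: "g \<in> unit_valued" "continuous_on S g"
  shows "continuous_on S (resolvent \<alpha> g)"
proof -
  have "bounded (g ` S)"
    using unit_valuedD(2,3)[OF g(1)] by (intro boundedI[of _ 1]) auto
  note [continuous_intros] = rate g(2) feller[OF g(2) this]
  have "continuous_on S (\<lambda>x. (qint S q g x + qrate q x * g x) / (\<alpha> + qrate q x))"
    using rate_pos[OF a] by (intro continuous_intros) force
  thus ?thesis by (simp add: resolvent_def[abs_def] qint_def)
qed

text \<open>The value 1 off \<open>K m\<close> will make the drift function grow, and continuous
  cutoffs keep every \<open>w m\<close> continuous, as Dini's theorem requires.\<close>

lemma superharmonic_exhaustion:
  assumes K: "\<And>n. K n \<subseteq> W n" "\<And>n. compact (K n)" "\<And>n. open (W n)" "\<And>n. W n \<inter> S \<subseteq> K (Suc n)"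
      "incseq K" "(\<Union>n. K n) = S"
    and rate: "continuous_on S (qrate q)"
    and feller: "\<And>f :: 'a \<Rightarrow> real. continuous_on S f \<Longrightarrow> bounded (f ` S) \<Longrightarrow> continuous_on S (qint S q f)"
    and a: "0 < \<alpha>" and zero: "\<And>x. x \<in> S \<Longrightarrow> explosion_mass \<alpha> x = 0"
  obtains w :: "nat \<Rightarrow> 'a \<Rightarrow> real" where "\<And>m. w m \<in> unit_valued" "\<And>m. continuous_on S (w m)"
    "\<And>m x. x \<in> S \<Longrightarrow> resolvent \<alpha> (w m) x \<le> w m x" "\<And>m x. x \<in> S - K m \<Longrightarrow> w m x = 1"
    "\<And>x. x \<in> S \<Longrightarrow> decseq (\<lambda>m. w m x)" "\<And>x. x \<in> S \<Longrightarrow> (\<lambda>m. w m x) \<longlonglongrightarrow> 0"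
proof -
  have "\<exists>\<phi> :: 'a \<Rightarrow> real. continuous_on UNIV \<phi> \<and> (\<forall>x. 0 \<le> \<phi> x \<and> \<phi> x \<le> 1) \<and>
      (\<forall>x\<in>K n. \<phi> x = 0) \<and> (\<forall>x. x \<notin> W n \<longrightarrow> \<phi> x = 1)" for n
    by (rule compact_cutoff[OF K(2) K(3) K(1), of n]) blast
  then obtain \<phi> :: "nat \<Rightarrow> 'a \<Rightarrow> real" where \<phi>: "\<And>n. continuous_on UNIV (\<phi> n)"
    "\<And>n x. 0 \<le> \<phi> n x" "\<And>n x. \<phi> n x \<le> 1" "\<And>n x. x \<in> K n \<Longrightarrow> \<phi> n x = 0" "\<And>n x. x \<notin> W n \<Longrightarrow> \<phi> n x = 1"
    by metis
  \<comment> \<open>On \<open>K (Suc m)\<close> the later cutoff is 0; off it, hence off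
    \<open>W m\<close>, the earlier one is 1.\<close>
  have \<phi>_dec: "\<phi> (Suc m) x \<le> \<phi> m x" if x: "x \<in> S" for m x
  proof (cases "x \<in> K (Suc m)")
    case True
    thus ?thesis using \<phi>(2)[of m x] \<phi>(4)[of x "Suc m"] by simp
  next
    case False
    hence "x \<notin> W m" using K(4)[of m] x by blast
    thus ?thesis using \<phi>(3)[of "Suc m" x] \<phi>(5)[of x m] by simp
  qed
  define w where "w = rec_nat (\<lambda>_. 1) (\<lambda>m f x. \<phi> m x + (1 - \<phi> m x) * resolvent \<alpha> f x)"
  have w0: "w 0 = (\<lambda>_. 1)"
    and wS: "w (Suc m) = (\<lambda>x. \<phi> m x + (1 - \<phi> m x) * resolvent \<alpha> (w m) x)" for m
    by (simp_all add: w_def)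
  have w: "w m \<in> unit_valued \<and> continuous_on S (w m)" for m
  proof (induction m)
    case 0 thus ?case by (simp add: w0 one_unit_valued)
  next
    case (Suc m)
    have c: "continuous_on S (w (Suc m))"
      unfolding wS using Suc
      by (intro continuous_intros continuous_resolvent[OF a rate feller] continuous_on_subset[OF \<phi>(1)]) auto
    have "0 \<le> w (Suc m) x \<and> w (Suc m) x \<le> 1" if x: "x \<in> S" for x
    proof -
      have r: "0 \<le> resolvent \<alpha> (w m) x" "resolvent \<alpha> (w m) x \<le> 1"
        using unit_valuedD(2,3)[OF resolvent_unit_valued[OF a] x] Suc by auto
      have "(1 - \<phi> m x) * resolvent \<alpha> (w m) x \<le> (1 - \<phi> m x) * 1"
        using r \<phi>(3)[of m x] by (intro mult_left_mono) auto
      moreover have "0 \<le> (1 - \<phi> m x) * resolvent \<alpha> (w m) x"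
        using r \<phi>(3)[of m x] by (intro mult_nonneg_nonneg) auto
      ultimately show ?thesis using \<phi>(2)[of m x] by (simp add: wS)
    qed
    thus ?case using c borel_measurable_continuous_on_restrict[OF c] by (simp add: unit_valued_def)
  qed
  note wu = w[THEN conjunct1]
  have r: "0 \<le> resolvent \<alpha> (w m) x" "resolvent \<alpha> (w m) x \<le> 1" if "x \<in> S" for m x
    using unit_valuedD(2,3)[OF resolvent_unit_valued[OF a wu] that] by auto
  have dec: "w (Suc m) x \<le> w m x" if "x \<in> S" for m x
    using that
  proof (induction m arbitrary: x)
    case 0 thus ?case using unit_valuedD(3)[OF wu] by (simp add: w0)
  next
    case (Suc m)
    let ?r = "resolvent \<alpha> (w (Suc m)) x" and ?r' = "resolvent \<alpha> (w m) x"
    have "?r \<le> ?r'"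
      by (rule resolvent_mono[OF a Suc.prems]) (use Suc wu in \<open>auto intro: integrable_unit_valued\<close>)
    hence "(1 - \<phi> (Suc m) x) * ?r \<le> (1 - \<phi> (Suc m) x) * ?r'"
      using \<phi>(3)[of "Suc m" x] by (intro mult_left_mono) auto
    \<comment> \<open>The recursion gives r + \<phi> (1 - r) with r at most 1, so shrinking the
      cutoff also lowers the value.\<close>
    moreover have "\<phi> (Suc m) x * (1 - ?r') \<le> \<phi> m x * (1 - ?r')"
      using \<phi>_dec[OF Suc.prems] r(2)[OF Suc.prems] by (intro mult_right_mono) auto
    ultimately show ?case unfolding wS[of "Suc m"] wS[of m] by (simp add: algebra_simps)
  qed
  have decs: "decseq (\<lambda>m. w m x)" if "x \<in> S" for x
    using dec[OF that] by (rule decseq_SucI)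
  have "resolvent \<alpha> (w m) x \<le> w (Suc m) x" if "x \<in> S" for m x
  proof -
    have "0 \<le> \<phi> m x * (1 - resolvent \<alpha> (w m) x)"
      using \<phi>(2)[of m x] r(2)[OF that] by simp
    thus ?thesis by (simp add: wS algebra_simps)
  qed
  hence super: "resolvent \<alpha> (w m) x \<le> w m x" if "x \<in> S" for m x
    using dec[OF that] that by (meson order_trans)
  define g where "g x = lim (\<lambda>m. w m x)" for x
  have lim: "(\<lambda>m. w m x) \<longlonglongrightarrow> g x" if x: "x \<in> S" for x
  proof -
    have "Bseq (\<lambda>m. w m x)"
      using unit_valuedD(2,3)[OF wu x] by (intro BseqI'[of _ 1]) auto
    hence "convergent (\<lambda>m. w m x)"
      using decseq_imp_monoseq[OF decs[OF x]] by (rule Bseq_monoseq_convergent)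
    thus ?thesis by (simp add: convergent_LIMSEQ_iff g_def)
  qed
  have gm: "g \<in> borel_measurable (borelS S)"
    by (rule borel_measurable_LIMSEQ_metric[where f=w, OF unit_valuedD(1)[OF wu]]) (use lim in auto)
  have g01: "0 \<le> g x \<and> g x \<le> 1" if x: "x \<in> S" for x
    using unit_valuedD(2,3)[OF wu x]
    by (intro conjI LIMSEQ_le_const[OF lim[OF x]] LIMSEQ_le_const2[OF lim[OF x]]) auto
  have gu: "g \<in> unit_valued" using gm g01 by (simp add: unit_valued_def)
  have fix_g: "g x = resolvent \<alpha> g x" if x: "x \<in> S" for x
  proof -
    obtain m0 where m0: "x \<in> K m0" using x K(6) by blast
    \<comment> \<open>From \<open>m0\<close> on, the cutoffs vanish at \<open>x\<close> and the
      recursion is the bare resolvent.\<close>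
    have "w (Suc m) x = resolvent \<alpha> (w m) x" if "m0 \<le> m" for m
      using \<phi>(4)[of x m] m0 incseqD[OF K(5) that] by (auto simp: wS)
    hence "eventually (\<lambda>m. resolvent \<alpha> (w m) x = w (Suc m) x) sequentially"
      unfolding eventually_sequentially by (intro exI[of _ m0]) simp
    moreover have "(\<lambda>m. resolvent \<alpha> (w m) x) \<longlonglongrightarrow> resolvent \<alpha> g x"
      by (rule resolvent_tendsto[OF a x wu gm lim])
    ultimately have "(\<lambda>m. w (Suc m) x) \<longlonglongrightarrow> resolvent \<alpha> g x"
      by (rule Lim_transform_eventually[rotated])
    thus ?thesis using LIMSEQ_unique LIMSEQ_Suc[OF lim[OF x]] by blast
  qed
  have "g x = 0" if x: "x \<in> S" for x
    using subsolution_le_explosion_mass[OF a gu _ x] fix_g zero[OF x] g01[OF x] by force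
  \<comment> \<open>\<open>w (Suc n)\<close> uses the cutoff with index \<open>n\<close>, which is 1
    off \<open>W n\<close> and so off \<open>K (Suc n)\<close>.\<close>
  moreover have "w m x = 1" if x: "x \<in> S - K m" for m x
  proof (cases m)
    case (Suc n)
    hence "x \<notin> W n" using K(4)[of n] x by blast
    thus ?thesis using \<phi>(5)[of x n] by (simp add: Suc wS)
  qed (simp add: w0)
  ultimately show ?thesis using that[of w] w super decs lim by fastforce
qed

text \<open>A sum of superharmonic functions is superharmonic. Smallness of the summands on compacts
  makes the sum finite; their value 1 far out makes it tend to infinity.\<close>

lemma drift_of_explosion_mass_eq_0:
  assumes lc: "locally_compact_space (top_of_set S)"
    and rate: "continuous_on S (qrate q)"
    and feller: "\<And>f :: 'a \<Rightarrow> real. continuous_on S f \<Longrightarrow> bounded (f ` S) \<Longrightarrow> continuous_on S (qint S q f)"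
    and a: "0 < \<alpha>" and zero: "\<And>x. x \<in> S \<Longrightarrow> explosion_mass \<alpha> x = 0"
  obtains Sn V where "drift_condition S q Sn V" "\<And>n. compact (Sn n)" "\<And>n. bdd_above (V ` Sn n)"
proof -
  obtain K W :: "nat \<Rightarrow> 'a set" where K: "\<And>n. compact (K n)" "\<And>n. open (W n)" "\<And>n. K n \<subseteq> W n"
    "\<And>n. W n \<inter> S \<subseteq> K (Suc n)" "incseq K" "(\<Union>n. K n) = S"
    using locally_compact_exhaustion[OF lc S_ne] by metis
  obtain w :: "nat \<Rightarrow> 'a \<Rightarrow> real" where wu: "\<And>m. w m \<in> unit_valued" and wc: "\<And>m. continuous_on S (w m)"
    and super: "\<And>m x. x \<in> S \<Longrightarrow> resolvent \<alpha> (w m) x \<le> w m x" and out: "\<And>m x. x \<in> S - K m \<Longrightarrow> w m x = 1"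
    and dec: "\<And>x. x \<in> S \<Longrightarrow> decseq (\<lambda>m. w m x)" and lim: "\<And>x. x \<in> S \<Longrightarrow> (\<lambda>m. w m x) \<longlonglongrightarrow> 0"
    using superharmonic_exhaustion[OF K(3,1,2,4-6) rate feller a zero] by blast
  note w01 = unit_valuedD(2,3)[OF wu]
  have KS: "K n \<subseteq> S" for n using K(6) by blast
  have "\<exists>m. \<forall>x\<in>K k. w m x < (1 / 2) ^ k" for k
    using dini_to_zero[of "K k" w "(1 / 2) ^ k"] K(1) continuous_on_subset[OF wc KS] dec lim KS[of k]
    by (metis order_refl subsetD zero_less_divide_1_iff zero_less_numeral zero_less_power)
  then obtain N where N: "\<And>k x. x \<in> K k \<Longrightarrow> w (N k) x < (1 / 2) ^ k" by metis
  define v where "v k = w (N k)" for k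
  define V where "V x = (\<Sum>k. v k x)" for x
  \<comment> \<open>A majorant of the summands on \<open>K n\<close>: the first \<open>n\<close> are
    at most 1, and \<open>K n \<subseteq> K k\<close> gives the geometric bound for the rest. It
    also bounds \<open>V\<close> on \<open>K n\<close>.\<close>
  define b :: "nat \<Rightarrow> nat \<Rightarrow> real" where "b n k = (if k < n then 1 else (1 / 2) ^ k)" for n k
  have sb: "summable (b n)" for n
    by (rule summable_comparison_test'[of "\<lambda>k. (1 / 2) ^ k" n]) (auto simp: b_def)
  have v01: "0 \<le> v k x" "v k x \<le> 1" if "x \<in> S" for k x using w01 that by (auto simp: v_def)
  have vb: "v k x \<le> b n k" if "x \<in> K n" for k n x
    using N[of x k] incseqD[OF K(5), of n k] that v01[of x k] KS[of n] by (auto simp: b_def v_def not_less intro: less_imp_le)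
  have sv: "summable (\<lambda>k. v k x)" if x: "x \<in> S" for x
  proof -
    obtain n where "x \<in> K n" using x K(6) by blast
    thus ?thesis using vb v01(1)[OF x] by (intro summable_comparison_test'[OF sb[of n], of 0]) auto
  qed
  have vm: "v k \<in> borel_measurable (borelS S)" for k unfolding v_def by (rule unit_valuedD(1)[OF wu])
  have Vm: "V \<in> borel_measurable (borelS S)" unfolding V_def[abs_def] by (rule borel_measurable_suminf[OF vm])
  have V0: "0 \<le> V x" if "x \<in> S" for x unfolding V_def using sv[OF that] v01(1)[OF that] by (rule suminf_nonneg)
  \<comment> \<open>Off \<open>K n\<close> each of the first \<open>j\<close> summands is 1 once
    their indices \<open>N k\<close> are at most \<open>n\<close>.\<close>
  have big: "real j \<le> V x" if x: "x \<in> S - K n" and n: "\<And>k. k < j \<Longrightarrow> N k \<le> n" for j n x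
  proof -
    have "v k x = 1" if "k < j" for k
      using out[of x "N k"] x incseqD[OF K(5) n[OF that]] by (auto simp: v_def)
    hence "real j = (\<Sum>k<j. v k x)" by simp
    also have "\<dots> \<le> V x" unfolding V_def
      using x v01(1) by (intro sum_le_suminf sv) auto
    finally show ?thesis .
  qed
  \<comment> \<open>Sum and integral are exchanged for nonnegative integrals; the finite bound then
    yields integrability of \<open>V\<close>.\<close>
  have intV: "integrable (qtilde S q x) V \<and> resolvent \<alpha> V x \<le> V x" if x: "x \<in> S" for x
  proof -
    note r = rate_pos[OF a x]
    have vi: "(\<integral>y. v k y \<partial>qtilde S q x) \<le> (\<alpha> + qrate q x) * v k x" for k
      using super[OF x, of "N k"] r by (simp add: resolvent_def v_def divide_le_eq mult.commute)
    have "(\<integral>\<^sup>+y. ennreal (V y) \<partial>qtilde S q x) = (\<integral>\<^sup>+y. (\<Sum>k. ennreal (v k y)) \<partial>qtilde S q x)"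
      unfolding V_def using sv v01(1) by (intro nn_integral_cong suminf_ennreal2[symmetric]) auto
    also have "\<dots> = (\<Sum>k. \<integral>\<^sup>+y. ennreal (v k y) \<partial>qtilde S q x)"
      using vm by (intro nn_integral_suminf) measurable
    also have "\<dots> = (\<Sum>k. ennreal (\<integral>y. v k y \<partial>qtilde S q x))"
      using v01(1) integrable_unit_valued[OF x wu]
      by (intro suminf_cong nn_integral_eq_integral AE_I2) (auto simp: v_def)
    also have "\<dots> \<le> (\<Sum>k. ennreal ((\<alpha> + qrate q x) * v k x))"
      by (intro suminf_le ennreal_leI vi) auto
    also have "\<dots> = ennreal (\<Sum>k. (\<alpha> + qrate q x) * v k x)"
      using r v01(1)[OF x] sv[OF x] by (intro suminf_ennreal2 summable_mult) auto
    also have "(\<Sum>k. (\<alpha> + qrate q x) * v k x) = (\<alpha> + qrate q x) * V x"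
      unfolding V_def by (rule suminf_mult[OF sv[OF x]])
    finally have nn: "(\<integral>\<^sup>+y. ennreal (V y) \<partial>qtilde S q x) \<le> ennreal ((\<alpha> + qrate q x) * V x)" .
    have VM: "V \<in> borel_measurable (qtilde S q x)" using Vm by measurable
    have int: "integrable (qtilde S q x) V"
      using nn V0 by (intro integrableI_nonneg[OF VM] AE_I2) (auto intro: le_less_trans)
    have "ennreal (\<integral>y. V y \<partial>qtilde S q x) \<le> ennreal ((\<alpha> + qrate q x) * V x)"
      using nn V0 by (subst nn_integral_eq_integral[OF int, symmetric]) auto
    hence "(\<integral>y. V y \<partial>qtilde S q x) \<le> (\<alpha> + qrate q x) * V x"
      using r V0[OF x] by (subst (asm) ennreal_le_iff) auto
    thus ?thesis using int r by (simp add: resolvent_def divide_le_eq mult.commute)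
  qed
  have "drift_condition S q K V"
    unfolding drift_condition_def
  proof (intro conjI ballI allI)
    show "K n \<in> sets (borelS S)" for n
      using compact_imp_closed[OF K(1)] KS[of n] by (subst sets_restrict_space_iff) (use S_borel in auto)
    show "bdd_above (qrate q ` K n)" for n
      using compact_continuous_image[OF continuous_on_subset[OF rate KS] K(1)]
      by (intro bounded_imp_bdd_above compact_imp_bounded)
    show "incseq (\<lambda>n. INF x\<in>S - K n. ereal (V x))"
    proof (intro incseq_SucI INF_superset_mono)
      fix n show "S - K (Suc n) \<subseteq> S - K n" using incseqD[OF K(5), of n "Suc n"] by auto
    qed simp
    show "(\<lambda>n. INF x\<in>S - K n. ereal (V x)) \<longlonglongrightarrow> \<infinity>"
      unfolding Lim_PInfty
    proof
      fix B :: real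
      obtain j :: nat where j: "B \<le> real j" using real_arch_simple by blast
      \<comment> \<open>\<open>N\<close> need not be monotone, hence the maximum over the first
        \<open>j\<close> indices; \<open>insert 0\<close> covers \<open>j = 0\<close>.\<close>
      have "ereal B \<le> (INF x\<in>S - K n. ereal (V x))" if "Max (insert 0 (N ` {..<j})) \<le> n" for n
      proof (rule INF_greatest)
        fix x assume x: "x \<in> S - K n"
        have "N k \<le> n" if "k < j" for k
          using \<open>Max (insert 0 (N ` {..<j})) \<le> n\<close> that by simp
        hence "real j \<le> V x" by (rule big[OF x])
        thus "ereal B \<le> ereal (V x)" using j by simp
      qed
      thus "\<exists>M. \<forall>n\<ge>M. ereal B \<le> (INF x\<in>S - K n. ereal (V x))" by blast
    qed
    show "\<exists>\<alpha>>0. \<forall>x\<in>S. integrable (qtilde S q x) V \<and> qint S q V x \<le> \<alpha> * V x"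
      using a intV le_qint_iff(2)[OF a] by blast
  qed (use Vm V0 K(5,6) in auto)
  moreover have "bdd_above (V ` K n)" for n
  proof (rule bdd_aboveI2)
    fix x assume x: "x \<in> K n"
    thus "V x \<le> (\<Sum>k. b n k)"
      unfolding V_def using KS by (intro suminf_le vb sv sb) auto
  qed
  ultimately show ?thesis using that K(1) by blast
qed

end

section \<open>Assembly of the four claims\<close>

theorem theorem3p3:
  fixes S :: "'a::polish_space set"
    and q :: "'a \<Rightarrow> 'a set \<Rightarrow> real"
    and P :: "'a \<Rightarrow> 'w measure"
    and T :: "nat \<Rightarrow> 'w \<Rightarrow> ennreal"
    and Z :: "nat \<Rightarrow> 'w \<Rightarrow> 'a option"
    and X :: "real \<Rightarrow> 'w \<Rightarrow> 'a option"
  assumes "S \<in> sets borel" and "S \<noteq> {}"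
    and "Q_function S q"
    and "\<And>x. x \<in> S \<Longrightarrow> pure_jump_process S q x (P x) T Z X"
  shows
    "((\<exists>Sn V. drift_condition S q Sn V) \<longrightarrow> nonexplosive S P T) \<and>
     (locally_compact_space (top_of_set S) \<and>
        continuous_on S (qrate q) \<and>
        (\<forall>f :: 'a \<Rightarrow> real. continuous_on S f \<and> bounded (f ` S) \<longrightarrow> continuous_on S (qint S q f)) \<longrightarrow>
        nonexplosive S P T \<longrightarrow>
        (\<exists>Sn V. drift_condition S q Sn V \<and>
           (\<forall>n. compact (Sn n) \<and> bdd_above (V ` Sn n)))) \<and>
     (nonexplosive S P T \<longleftrightarrow>
        (\<forall>\<alpha>>0. \<not> (\<exists>U :: 'a \<Rightarrow> real.
           U \<in> borel_measurable (restrict_space borel S) \<and>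
           (\<forall>x\<in>S. 0 \<le> U x \<and> U x \<le> 1) \<and> (\<exists>x\<in>S. U x \<noteq> 0) \<and>
           (\<forall>x\<in>S. \<alpha> * U x = qint S q U x)))) \<and>
     (explosive S P T \<longleftrightarrow>
        (\<exists>(U :: 'a \<Rightarrow> real) \<alpha>. \<alpha> > 0 \<and>
           U \<in> borel_measurable (restrict_space borel S) \<and>
           (\<forall>x\<in>S. 0 \<le> U x) \<and> bounded (U ` S) \<and> (\<exists>x\<in>S. U x \<noteq> 0) \<and>
           (\<forall>x\<in>S. \<alpha> * U x \<le> qint S q U x)))"
    (is "?A \<and> ?B \<and> (_ \<longleftrightarrow> (\<forall>\<alpha>>0. \<not> (\<exists>U. ?sol \<alpha> U))) \<and> (_ \<longleftrightarrow> (\<exists>U \<alpha>. ?sub U \<alpha>))")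
proof -
  interpret Q_space S q by unfold_locales (fact assms)+
  have nonexplosive_iff: "nonexplosive S P T \<longleftrightarrow> (\<forall>x\<in>S. explosion_mass \<alpha> x = 0)" if "0 < \<alpha>" for \<alpha>
    unfolding nonexplosive_def using almost_surely_nonexplosive_iff[OF assms(4) _ that] by simp
  have explosive_iff: "explosive S P T \<longleftrightarrow> \<not> nonexplosive S P T"
    unfolding explosive_def nonexplosive_def
    using prob_space.prob_le_1[OF pure_jump_processD(1)[OF assms(4)]] by (auto simp: less_le)
  have A: ?A
  proof (intro impI, elim exE)
    fix Sn V assume d: "drift_condition S q Sn V"
    show "nonexplosive S P T"
      by (rule explosion_mass_eq_0_of_drift[OF d]) (simp add: nonexplosive_iff)
  qed
  have B: ?B
  proof (intro impI)
    assume top: "locally_compact_space (top_of_set S) \<and> continuous_on S (qrate q) \<and>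
        (\<forall>f :: 'a \<Rightarrow> real. continuous_on S f \<and> bounded (f ` S) \<longrightarrow> continuous_on S (qint S q f))"
      and ne: "nonexplosive S P T"
    have zero: "explosion_mass 1 x = 0" if "x \<in> S" for x using nonexplosive_iff[of 1] ne that by simp
    obtain Sn V where "drift_condition S q Sn V" "\<And>n. compact (Sn n)" "\<And>n. bdd_above (V ` Sn n)"
      by (rule drift_of_explosion_mass_eq_0[of 1]) (use top zero in auto)
    thus "\<exists>Sn V. drift_condition S q Sn V \<and> (\<forall>n. compact (Sn n) \<and> bdd_above (V ` Sn n))"
      by (intro exI conjI allI)
  qed
  \<comment> \<open>Dividing by an upper bound \<open>B\<close>, positive because \<open>U\<close>
    is nontrivial, makes \<open>U\<close> a \<open>[0,1]\<close>-valued subsolution below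
    \<open>explosion_mass\<close>.\<close>
  have no_sub: "\<not> nonexplosive S P T" if sub: "?sub U \<alpha>" for U \<alpha>
  proof -
    have a: "0 < \<alpha>" and Um: "U \<in> borel_measurable (restrict_space borel S)"
      and U0: "\<And>x. x \<in> S \<Longrightarrow> 0 \<le> U x" and Ub: "bounded (U ` S)"
      and Us: "\<And>x. x \<in> S \<Longrightarrow> \<alpha> * U x \<le> qint S q U x" using sub by auto
    obtain x where x: "x \<in> S" "U x \<noteq> 0" using sub by blast
    obtain B where B: "\<And>y. y \<in> S \<Longrightarrow> U y \<le> B"
      using Ub U0 by (auto simp: bounded_iff)
    have Bpos: "0 < B" using B[OF x(1)] U0[OF x(1)] x(2) by linarith
    define u where "u y = U y / B" for y
    have u: "u \<in> unit_valued"
      using Um U0 B Bpos by (auto simp: unit_valued_def u_def[abs_def] divide_le_eq)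
    have "u y \<le> resolvent \<alpha> u y" if y: "y \<in> S" for y
    proof -
      have "U y / B \<le> resolvent \<alpha> U y / B"
        using Us[OF y] le_qint_iff(1)[OF a y] Bpos by (intro divide_right_mono) auto
      thus ?thesis by (simp add: u_def resolvent_def mult.commute)
    qed
    hence "u x \<le> explosion_mass \<alpha> x" by (rule subsolution_le_explosion_mass[OF a u _ x(1)])
    moreover have "0 < u x" using U0[OF x(1)] x(2) Bpos by (simp add: u_def less_le)
    ultimately show ?thesis using nonexplosive_iff[OF a] x(1) by force
  qed
  \<comment> \<open>The explosion mass for \<alpha> = 1 is itself the solution. Since solutions are
    bounded subsolutions, this and \<open>no_sub\<close> give both (c) and (d).\<close>
  have sol: "\<exists>U. ?sol 1 U" if "\<not> nonexplosive S P T"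
  proof -
    note e = explosion_mass_unit_valued[of 1]
    have "\<exists>x\<in>S. explosion_mass 1 x \<noteq> 0" using that nonexplosive_iff[of 1] by simp
    moreover have "1 * explosion_mass 1 x = qint S q (explosion_mass 1) x" if "x \<in> S" for x
      using explosion_mass_fixpoint[of 1 x] le_qint_iff(3)[of 1 x "explosion_mass 1"] that by simp
    ultimately show ?thesis using e by (intro exI[of _ "explosion_mass 1"]) (auto simp: unit_valued_def)
  qed
  have sol_sub: "?sub U \<alpha>" if "0 < \<alpha>" "?sol \<alpha> U" for U \<alpha>
  proof -
    have "bounded (U ` S)" using that(2) by (intro boundedI[of _ 1]) auto
    thus ?thesis using that by auto
  qed
  have C: "nonexplosive S P T \<longleftrightarrow> (\<forall>\<alpha>>0. \<not> (\<exists>U. ?sol \<alpha> U))"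
  proof
    assume ne: "nonexplosive S P T"
    show "\<forall>\<alpha>>0. \<not> (\<exists>U. ?sol \<alpha> U)"
    proof (intro allI impI notI)
      fix \<alpha> :: real assume a: "0 < \<alpha>" and "\<exists>U. ?sol \<alpha> U"
      then obtain U where U: "?sol \<alpha> U" by (elim exE)
      show False using no_sub[OF sol_sub[OF a U]] ne by (rule notE)
    qed
  next
    assume none: "\<forall>\<alpha>>0. \<not> (\<exists>U. ?sol \<alpha> U)"
    show "nonexplosive S P T"
      using none[rule_format, OF zero_less_one] by (rule contrapos_np) (rule sol)
  qed
  have D: "explosive S P T \<longleftrightarrow> (\<exists>U \<alpha>. ?sub U \<alpha>)"
  proof
    assume "explosive S P T"
    hence "\<exists>U. ?sol 1 U" unfolding explosive_iff by (rule sol)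
    then obtain U where "?sol 1 U" by (elim exE)
    hence "?sub U 1" by (rule sol_sub[OF zero_less_one])
    thus "\<exists>U \<alpha>. ?sub U \<alpha>" by (intro exI)
  next
    assume "\<exists>U \<alpha>. ?sub U \<alpha>"
    then obtain U \<alpha> where "?sub U \<alpha>" by (elim exE)
    thus "explosive S P T" unfolding explosive_iff by (rule no_sub)
  qed
  show ?thesis by (intro conjI A B C D)
qed

end
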